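(* The equality $$\|x\cdot\nabla\varphi\|^2=\Bigl\|x\cdot\nabla\varphi+\frac n2\varphi\Bigr\|^2+\left(\frac n2\right)^2\|\varphi\|^2$$ holds for all $\varphi\in H^1(\mathbb{R}^n)$ with $x\cdot\nabla\varphi\in L^2(\mathbb{R}^n)$. Moreover, there does not exist $\varphi\in H^1(\mathbb{R}^n)\setminus\{0\}$ with $x\cdot\nabla\varphi\in L^2(\mathbb{R}^n)$ satisfying $$\|x\cdot\nabla\varphi\|^2=\left(\frac n2\right)^2\|\varphi\|^2.$$
   Context: $L^2(\mathbb{R}^n)$ is the space of complex-valued square integrable functions with norm $\|\cdot\|$. $H^1(\mathbb{R}^n)=\{\varphi\in L^2(\mathbb{R}^n):\partial_j\varphi\in L^2(\mathbb{R}^n)\text{ for all }1\le j\le n\}$, with distributional derivatives. $x\cdot\nabla\varphi=\sum_{j=1}^n x_j\partial_j\varphi$. *)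

theory Defs
  imports "HOL-Analysis.Analysis"
begin

text \<open>
  Elements of \<open>L\<^sup>2(\<real>\<^sup>n)\<close> are represented by Lebesgue measurable functions; equality in \<open>L\<^sup>2\<close> is
  equality almost everywhere. The dimension is \<open>n = CARD('n)\<close>.
\<close>

definition L2 :: "(real ^ 'n \<Rightarrow> complex) set" where
  "L2 = {f. f \<in> borel_measurable lebesgue \<and> integrable lebesgue (\<lambda>x. (cmod (f x))\<^sup>2)}"

definition L2_norm :: "(real ^ 'n \<Rightarrow> complex) \<Rightarrow> real" where
  "L2_norm f = sqrt (\<integral>x. (cmod (f x))\<^sup>2 \<partial>lebesgue)"

definition partial_deriv :: "'n \<Rightarrow> (real ^ 'n \<Rightarrow> complex) \<Rightarrow> real ^ 'n \<Rightarrow> complex" where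
  "partial_deriv j f = (\<lambda>x. frechet_derivative f (at x) (axis j 1))"

text \<open>
  A function is \<open>C\<^sup>\<infinity>\<close> iff all its iterated partial derivatives (including itself) are everywhere
  Frechet differentiable, hence also continuous.
\<close>

definition smooth :: "(real ^ 'n \<Rightarrow> complex) \<Rightarrow> bool" where
  "smooth f \<longleftrightarrow> (\<forall>js. \<forall>x. foldr partial_deriv js f differentiable (at x))"

definition test_functions :: "(real ^ 'n \<Rightarrow> complex) set" where
  "test_functions = {\<eta>. smooth \<eta> \<and> compact (closure {x. \<eta> x \<noteq> 0})}"

definition locally_integrable :: "(real ^ 'n \<Rightarrow> complex) \<Rightarrow> bool" where
  "locally_integrable f \<longleftrightarrow> (\<forall>K. compact K \<longrightarrow> set_integrable lebesgue K f)"

definition has_weak_partial ::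
    "(real ^ 'n \<Rightarrow> complex) \<Rightarrow> 'n \<Rightarrow> (real ^ 'n \<Rightarrow> complex) \<Rightarrow> bool" where
  "has_weak_partial f j g \<longleftrightarrow> locally_integrable f \<and> locally_integrable g \<and>
     (\<forall>\<eta>\<in>test_functions.
        (\<integral>x. f x * partial_deriv j \<eta> x \<partial>lebesgue) = - (\<integral>x. g x * \<eta> x \<partial>lebesgue))"

definition H1 :: "(real ^ 'n \<Rightarrow> complex) set" where
  "H1 = {\<phi>\<in>L2. \<forall>j. \<exists>g\<in>L2. has_weak_partial \<phi> j g}"

text \<open>
  A representative of the distributional derivative of \<open>\<phi> \<in> H1\<close>. It is determined up to a null set,
  so nothing below depends on the choice.
\<close>

definition weak_partial :: "'n \<Rightarrow> (real ^ 'n \<Rightarrow> complex) \<Rightarrow> real ^ 'n \<Rightarrow> complex" where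
  "weak_partial j \<phi> = (SOME g. g \<in> L2 \<and> has_weak_partial \<phi> j g)"

definition x_dot_grad :: "(real ^ 'n \<Rightarrow> complex) \<Rightarrow> real ^ 'n \<Rightarrow> complex" where
  "x_dot_grad \<phi> = (\<lambda>x. \<Sum>j\<in>UNIV. of_real (x $ j) * weak_partial j \<phi> x)"

end

theory Submission
  imports Defs
begin

text \<open>
  The dilations \<open>U\<^sub>t f(x) = e\<^bsup>nt/2\<^esup> f(e\<^bsup>t\<^esup> x)\<close> are unitary on \<open>L\<^sup>2\<close> and their generator is
  \<open>A = x \<cdot> \<nabla> + n/2\<close>, so \<open>A\<close> is skew-adjoint and \<open>Re \<langle>A\<phi>, \<phi>\<rangle> = 0\<close>; expanding
  \<open>\<parallel>x \<cdot> \<nabla>\<phi>\<parallel>\<^sup>2 = \<parallel>A\<phi> - (n/2) \<phi>\<parallel>\<^sup>2\<close> gives the equality. In the case of equality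
  \<open>A\<phi> = 0\<close>, so \<open>\<phi>\<close> is invariant under all \<open>U\<^sub>t\<close>; since \<open>U\<^sub>t\<close> concentrates any test function
  near the origin as \<open>t \<rightarrow> \<infinity>\<close>, \<open>\<phi>\<close> is orthogonal to all test functions. The weak derivatives are
  only ever paired with test functions: \<open>\<integral> \<phi> U\<^sub>t \<eta>\<close> has derivative \<open>- \<integral> A\<phi> U\<^sub>t \<eta>\<close>, hence
  \<open>\<bar>\<integral> \<phi> (U\<^sub>t \<eta> - \<eta>)\<bar> \<le> \<bar>t\<bar> \<parallel>A\<phi>\<parallel> \<parallel>\<eta>\<parallel>\<close>, and by density this uniform bound carries the derivative at
  \<open>t = 0\<close> over to \<open>\<eta> = cnj \<phi>\<close>.
\<close>

section \<open>Smooth functions and bump functions\<close>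

text \<open>Smoothness is the largest property that implies differentiability and passes to partial
  derivatives. Exhibiting a set \<open>S\<close> with these two properties therefore replaces an
  induction over lists of directions in the closure proofs below.\<close>

lemma smooth_coinduct:
  assumes "f \<in> S"
    and "\<And>f x. f \<in> S \<Longrightarrow> f differentiable (at x)"
    and "\<And>f j. f \<in> S \<Longrightarrow> partial_deriv j f \<in> S"
  shows "smooth f"
proof -
  have "foldr partial_deriv js f \<in> S" for js
    by (induction js) (use assms in auto)
  with assms(2) show ?thesis by (auto simp: smooth_def)
qed

lemma smooth_differentiable: "smooth f \<Longrightarrow> f differentiable (at x)"
  unfolding smooth_def by (metis foldr.simps(1) id_apply)

lemma smooth_partial_deriv: "smooth f \<Longrightarrow> smooth (partial_deriv j f)"
  unfolding smooth_def
proof (intro allI)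
  fix js x assume "\<forall>js x. foldr partial_deriv js f differentiable (at x)"
  \<comment> \<open>\<open>foldr\<close> applies the last entry of the list first, so appending
    \<open>j\<close> differentiates in direction \<open>j\<close> before all the others.\<close>
  then have "foldr partial_deriv (js @ [j]) f differentiable (at x)" by blast
  then show "foldr partial_deriv js (partial_deriv j f) differentiable (at x)" by simp
qed

lemma smooth_has_derivative:
  "smooth f \<Longrightarrow> (f has_derivative frechet_derivative f (at x)) (at x)"
  using frechet_derivative_works smooth_differentiable by blast

lemma smooth_continuous_on: "smooth f \<Longrightarrow> continuous_on A f"
  by (meson continuous_at_imp_continuous_on differentiable_imp_continuous_within
      smooth_differentiable)

lemma partial_deriv_eqI:
  assumes "\<And>x. (f has_derivative f' x) (at x)"
  shows "partial_deriv j f = (\<lambda>x. f' x (axis j 1))"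
  using frechet_derivative_at[OF assms] unfolding partial_deriv_def by metis

lemma partial_deriv_add:
  assumes "\<And>x. f differentiable (at x)" "\<And>x. g differentiable (at x)"
  shows "partial_deriv j (\<lambda>x. f x + g x) = (\<lambda>x. partial_deriv j f x + partial_deriv j g x)"
  using assms unfolding frechet_derivative_works
  by (subst partial_deriv_eqI[OF has_derivative_add]) (auto simp: partial_deriv_def)

lemma partial_deriv_mult:
  fixes f g :: "real ^ 'n \<Rightarrow> complex"
  assumes "\<And>x. f differentiable (at x)" "\<And>x. g differentiable (at x)"
  shows "partial_deriv j (\<lambda>x. f x * g x) =
    (\<lambda>x. f x * partial_deriv j g x + partial_deriv j f x * g x)"
  using assms unfolding frechet_derivative_works
  by (subst partial_deriv_eqI[OF has_derivative_mult]) (auto simp: partial_deriv_def)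

text \<open>Finite sums of generators from \<open>B\<close> with smooth coefficients. Such a span
  can be closed under differentiation even when \<open>B\<close> itself is not, because the
  coefficients absorb the factors produced by the chain rule.\<close>

inductive_set product_span :: "(real ^ 'n \<Rightarrow> complex) set \<Rightarrow> (real ^ 'n \<Rightarrow> complex) set"
  for B where
  mult: "smooth f \<Longrightarrow> g \<in> B \<Longrightarrow> (\<lambda>x. f x * g x) \<in> product_span B"
| add: "f \<in> product_span B \<Longrightarrow> g \<in> product_span B \<Longrightarrow> (\<lambda>x. f x + g x) \<in> product_span B"

text \<open>The Leibniz rule splits the derivative of \<open>f * g\<close> into a term with the
  smooth coefficient \<open>partial_deriv j f\<close> and a term covered by \<open>deriv\<close>, so
  coinduction applies to the whole span. It serves twice: for products, with all smooth functions as
  generators, and for bumps, whose derivatives are expressed through other members of the same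
  family.\<close>

lemma smooth_product_span:
  assumes diff: "\<And>g x. g \<in> B \<Longrightarrow> g differentiable (at x)"
    and deriv: "\<And>f g j. smooth f \<Longrightarrow> g \<in> B \<Longrightarrow> (\<lambda>x. f x * partial_deriv j g x) \<in> product_span B"
    and f: "f \<in> product_span B"
  shows "smooth f"
proof (rule smooth_coinduct[OF f])
  have *: "\<forall>x. h differentiable (at x)" if "h \<in> product_span B" for h
    using that
  proof induction
    case (mult f g)
    then show ?case using diff smooth_differentiable differentiable_mult by metis
  qed auto
  then show "\<And>h x. h \<in> product_span B \<Longrightarrow> h differentiable at x" by blast
  show "partial_deriv j h \<in> product_span B" if "h \<in> product_span B" for h j
    using that
  proof induction
    case (mult f g)
    have "(\<lambda>x. f x * partial_deriv j g x) \<in> product_span B"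
      using mult deriv by blast
    moreover have "(\<lambda>x. partial_deriv j f x * g x) \<in> product_span B"
      using product_span.mult mult smooth_partial_deriv by blast
    ultimately show ?case
      using mult diff by (simp add: partial_deriv_mult smooth_differentiable product_span.add)
  next
    case (add f g)
    then show ?case using * by (simp add: partial_deriv_add product_span.add)
  qed
qed

lemma smooth_const [simp]: "smooth (\<lambda>x. c)"
proof (rule smooth_coinduct[where S = "range (\<lambda>c x. c)"])
  fix f :: "real ^ 'n \<Rightarrow> complex" and j assume "f \<in> range (\<lambda>c x. c)"
  then show "partial_deriv j f \<in> range (\<lambda>c x. c)"
    using partial_deriv_eqI[of f "\<lambda>x y. 0" j] by auto
qed auto

lemma smooth_add:
  assumes "smooth f" "smooth g"
  shows "smooth (\<lambda>x. f x + g x)"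
proof (rule smooth_coinduct[where S = "{\<lambda>x. f x + g x | f g. smooth f \<and> smooth g}"])
  fix h :: "real ^ 'n \<Rightarrow> complex" and j
  assume "h \<in> {\<lambda>x. f x + g x | f g. smooth f \<and> smooth g}"
  then show "partial_deriv j h \<in> {\<lambda>x. f x + g x | f g. smooth f \<and> smooth g}"
    using smooth_partial_deriv partial_deriv_add[OF smooth_differentiable smooth_differentiable]
    by blast
next
  fix h :: "real ^ 'n \<Rightarrow> complex" and x
  assume "h \<in> {\<lambda>x. f x + g x | f g. smooth f \<and> smooth g}"
  then show "h differentiable (at x)"
    by (auto intro: differentiable_add smooth_differentiable)
qed (use assms in auto)

lemma smooth_mult:
  assumes "smooth f" "smooth g"
  shows "smooth (\<lambda>x. f x * g x)"
  by (rule smooth_product_span[where B = "Collect smooth"])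
    (auto intro!: product_span.mult smooth_differentiable smooth_partial_deriv assms)

section \<open>Coordinate functions and rescaled smooth functions\<close>

lemma has_derivative_component:
  "((\<lambda>x. complex_of_real (x $ i)) has_derivative (\<lambda>h. complex_of_real (h $ i))) (at x)"
  by (rule bounded_linear_imp_has_derivative)
    (auto intro: bounded_linear_compose[OF bounded_linear_of_real bounded_linear_vec_nth])

lemma partial_deriv_component:
  "partial_deriv j (\<lambda>x. complex_of_real (x $ i)) = (\<lambda>x. if i = j then 1 else 0)"
  by (subst partial_deriv_eqI[OF has_derivative_component]) (auto simp: axis_def)

lemma smooth_component [simp]: "smooth (\<lambda>x. complex_of_real (x $ i))"
  by (rule smooth_coinduct[where S = "insert (\<lambda>x. complex_of_real (x $ i)) (Collect smooth)"])
    (auto simp: partial_deriv_component intro: smooth_differentiable smooth_partial_deriv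
        differentiableI[OF has_derivative_component])

lemma partial_deriv_dilation:
  assumes "smooth f"
  shows "partial_deriv j (\<lambda>x. f (a *\<^sub>R x)) = (\<lambda>x. complex_of_real a * partial_deriv j f (a *\<^sub>R x))"
proof -
  have "((\<lambda>x. f (a *\<^sub>R x)) has_derivative (\<lambda>h. frechet_derivative f (at (a *\<^sub>R x)) (a *\<^sub>R h))) (at x)" for x
    by (rule has_derivative_compose[OF _ smooth_has_derivative[OF assms], of "\<lambda>x. a *\<^sub>R x"])
      (auto intro!: derivative_eq_intros)
  moreover have "frechet_derivative f (at y) (a *\<^sub>R h) = complex_of_real a * frechet_derivative f (at y) h" for y h
    using linear_frechet_derivative[OF smooth_differentiable[OF assms]]
    by (simp add: linear_scale flip: scaleR_conv_of_real)
  ultimately show ?thesis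
    by (subst partial_deriv_eqI) (auto simp: partial_deriv_def)
qed

lemma smooth_dilation:
  assumes "smooth f"
  shows "smooth (\<lambda>x. f (a *\<^sub>R x))"
\<comment> \<open>The scalar \<open>c\<close> in the set absorbs the factor \<open>a\<close> that
  the chain rule contributes with every derivative.\<close>
proof (rule smooth_coinduct[where S = "{\<lambda>x. c * f (a *\<^sub>R x) | c f. smooth f}"])
  show "(\<lambda>x. f (a *\<^sub>R x)) \<in> {\<lambda>x. c * f (a *\<^sub>R x) | c f. smooth f}"
    using assms by (intro CollectI exI[of _ 1] exI[of _ f]) auto
next
  fix h :: "real ^ 'n \<Rightarrow> complex"
  assume "h \<in> {\<lambda>x. c * f (a *\<^sub>R x) | c f. smooth f}"
  then obtain c f where h: "h = (\<lambda>x. c * f (a *\<^sub>R x))" "smooth f" by blast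
  have d: "(\<lambda>x. f (a *\<^sub>R x)) differentiable (at x)" for x
    by (rule differentiable_compose[OF smooth_differentiable[OF h(2)]]) auto
  then show "h differentiable (at x)" for x
    unfolding h by auto
  have "partial_deriv j h = (\<lambda>x. (c * of_real a) * partial_deriv j f (a *\<^sub>R x))" for j
    unfolding h using d partial_deriv_eqI[of "\<lambda>x. c" "\<lambda>x y. 0" j]
    by (subst partial_deriv_mult) (auto simp: partial_deriv_dilation[OF h(2)])
  then show "partial_deriv j h \<in> {\<lambda>x. c * f (a *\<^sub>R x) | c f. smooth f}" for j
    using h(2) smooth_partial_deriv by blast
qed

text \<open>The powers \<open>t ^ m\<close> make the family closed under differentiation.\<close>

definition bump :: "real \<Rightarrow> nat \<Rightarrow> real \<Rightarrow> real" where
  "bump c m t = (if t > 0 then exp (- (c / t)) / t ^ m else 0)"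

text \<open>The exponential beats every power: with \<open>s = 1 / t\<close> the right limit becomes
  that of \<open>s ^ m / exp (c * s)\<close> at infinity. To the left of 0 the function vanishes
  identically.\<close>

lemma bump_tendsto_0:
  assumes "c > 0"
  shows "(bump c m \<longlongrightarrow> 0) (at 0)"
proof -
  have "((\<lambda>t. exp (- (c / t)) / t ^ m) \<longlongrightarrow> 0) (at_right 0)"
  proof -
    have "((\<lambda>s. s ^ m / exp (c * s)) \<longlongrightarrow> 0) at_top"
      by (rule Lim_transform_eventually[OF tendsto_mult_left_zero[OF filterlim_compose[OF
            tendsto_power_div_exp_0[of m] filterlim_tendsto_pos_mult_at_top[OF tendsto_const assms
            filterlim_ident]], of "inverse (c ^ m)"]])
        (use assms in \<open>simp add: power_mult_distrib\<close>)
    then have "((\<lambda>t. (inverse t) ^ m / exp (c * inverse t)) \<longlongrightarrow> 0) (at_right 0)"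
      by (rule filterlim_compose[OF _ filterlim_inverse_at_top_right])
    then show ?thesis by (simp add: divide_simps exp_minus power_inverse mult.commute)
  qed
  then have "(bump c m \<longlongrightarrow> 0) (at_right 0)"
    by (rule Lim_transform_eventually)
      (auto simp: bump_def eventually_at_filter)
  moreover have "(bump c m \<longlongrightarrow> 0) (at_left 0)"
    by (rule tendsto_eventually) (auto simp: bump_def eventually_at_filter)
  ultimately show ?thesis using filterlim_split_at by blast
qed

text \<open>For \<open>t > 0\<close> this is the quotient rule, and for \<open>t < 0\<close> both
  sides vanish. At 0 the difference quotient \<open>bump c m h / h\<close> equals
  \<open>bump c (Suc m) h\<close>, which tends to 0. Hence one formula holds on the whole line and
  stays inside the family.\<close>

lemma bump_has_field_derivative:
  assumes "c > 0"
  shows "(bump c m has_field_derivative c * bump c (m + 2) t - real m * bump c (m + 1) t) (at t)"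
proof (cases t "0::real" rule: linorder_cases)
  case less
  have "((\<lambda>t. 0) has_field_derivative 0) (at t)" by simp
  then have "(bump c m has_field_derivative 0) (at t)"
    by (rule has_field_derivative_transform_within_open[where S = "{..<0}"])
      (use less in \<open>auto simp: bump_def\<close>)
  then show ?thesis using less by (simp add: bump_def)
next
  case equal
  have "((\<lambda>h. bump c m h / h) \<longlongrightarrow> 0) (at 0)"
    using bump_tendsto_0[OF assms, of "Suc m"]
    by (rule Lim_transform_eventually) (auto simp: bump_def eventually_at_filter)
  then show ?thesis using equal by (simp add: has_field_derivative_iff bump_def)
next
  case greater
  have "((\<lambda>t. exp (- (c / t)) / t ^ m) has_field_derivative
      c * bump c (m + 2) t - real m * bump c (m + 1) t) (at t)"
    using greater
    apply (auto intro!: derivative_eq_intros simp: bump_def)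
    apply (cases m; simp add: field_simps power2_eq_square)
    done
  then show ?thesis
    by (rule has_field_derivative_transform_within_open[where S = "{0<..}"])
      (use greater in \<open>auto simp: bump_def\<close>)
qed

text \<open>Since \<open>x \<bullet> x\<close> is a polynomial, each derivative raises
  \<open>m\<close> by 1 or 2 and multiplies by a constant times \<open>x $ j\<close>. The family
  over all \<open>m\<close> thus generates a span that is closed under differentiation.\<close>

lemma smooth_bump_quad:
  assumes "c > 0"
  shows "smooth (\<lambda>x :: real ^ 'n. complex_of_real (bump c m (R\<^sup>2 - x \<bullet> x)))"
proof -
  define B where "B = range (\<lambda>m (x :: real ^ 'n). complex_of_real (bump c m (R\<^sup>2 - x \<bullet> x)))"
  have der: "((\<lambda>x :: real ^ 'n. complex_of_real (bump c m (R\<^sup>2 - x \<bullet> x))) has_derivative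
     (\<lambda>h. of_real ((c * bump c (m + 2) (R\<^sup>2 - x \<bullet> x) - real m * bump c (m + 1) (R\<^sup>2 - x \<bullet> x))
        * (- 2 * (x \<bullet> h))))) (at x)" for x m
  proof (intro has_derivative_of_real)
    have 1: "((\<lambda>x :: real ^ 'n. R\<^sup>2 - x \<bullet> x) has_derivative (\<lambda>h. - 2 * (x \<bullet> h))) (at x)"
      by (auto intro!: derivative_eq_intros simp: inner_commute)
    show "((\<lambda>x :: real ^ 'n. bump c m (R\<^sup>2 - x \<bullet> x)) has_derivative
     (\<lambda>h. ((c * bump c (m + 2) (R\<^sup>2 - x \<bullet> x) - real m * bump c (m + 1) (R\<^sup>2 - x \<bullet> x))
        * (- 2 * (x \<bullet> h))))) (at x)"
      using has_derivative_compose[OF 1 bump_has_field_derivative[OF assms,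
            unfolded has_field_derivative_def]] .
  qed
  have pd: "partial_deriv j (\<lambda>x :: real ^ 'n. complex_of_real (bump c m (R\<^sup>2 - x \<bullet> x))) =
     (\<lambda>x. (of_real (- 2 * c) * of_real (x $ j)) * of_real (bump c (m + 2) (R\<^sup>2 - x \<bullet> x)) +
        (of_real (2 * real m) * of_real (x $ j)) * of_real (bump c (m + 1) (R\<^sup>2 - x \<bullet> x)))" for j m
    by (subst partial_deriv_eqI[OF der]) (auto simp: inner_axis algebra_simps)
  show ?thesis
  proof (rule smooth_product_span[where B = B])
    show "g differentiable (at x)" if "g \<in> B" for g x
      using that der unfolding B_def by (auto intro: differentiableI)
    show "(\<lambda>x. f x * partial_deriv j g x) \<in> product_span B" if f: "smooth f" and gB: "g \<in> B" for f g j
    proof -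
      obtain m where g: "g = (\<lambda>x. complex_of_real (bump c m (R\<^sup>2 - x \<bullet> x)))"
        using gB unfolding B_def by blast
      have "(\<lambda>x. (f x * (of_real (- 2 * c) * of_real (x $ j))) * of_real (bump c (m + 2) (R\<^sup>2 - x \<bullet> x)) +
        (f x * (of_real (2 * real m) * of_real (x $ j))) * of_real (bump c (m + 1) (R\<^sup>2 - x \<bullet> x))) \<in> product_span B"
        by (intro product_span.intros smooth_mult f smooth_const smooth_component) (auto simp: B_def)
      then show ?thesis unfolding g pd by (simp only: distrib_left mult.assoc)
    qed
    have "(\<lambda>x. 1 * complex_of_real (bump c m (R\<^sup>2 - x \<bullet> x))) \<in> product_span B"
      by (intro product_span.intros smooth_const) (auto simp: B_def)
    then show "(\<lambda>x. complex_of_real (bump c m (R\<^sup>2 - x \<bullet> x))) \<in> product_span B" by simp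
  qed
qed

section \<open>The space of square integrable functions\<close>

lemma L2_measurable: "f \<in> L2 \<Longrightarrow> f \<in> borel_measurable lebesgue"
  and L2_integrable: "f \<in> L2 \<Longrightarrow> integrable lebesgue (\<lambda>x. (cmod (f x))\<^sup>2)"
  by (auto simp: L2_def)

lemma L2_norm_nonneg [simp]: "L2_norm f \<ge> 0"
  by (simp add: L2_norm_def)

lemma L2_norm_squared: "(L2_norm f)\<^sup>2 = (\<integral>x. (cmod (f x))\<^sup>2 \<partial>lebesgue)"
  by (simp add: L2_norm_def)

lemma L2_dominated:
  assumes "g \<in> L2" "f \<in> borel_measurable lebesgue" "\<And>x. cmod (f x) \<le> cmod (g x)"
  shows "f \<in> L2" 
proof -
  have "integrable lebesgue (\<lambda>x. (cmod (f x))\<^sup>2)"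
    by (rule Bochner_Integration.integrable_bound[OF L2_integrable[OF assms(1)]])
      (use assms(2,3) in \<open>auto intro: power_mono\<close>)
  then show ?thesis using assms by (simp add: L2_def)
qed

lemma L2_mult_integrable_norm:
  assumes "f \<in> L2" "g \<in> L2"
  shows "integrable lebesgue (\<lambda>x. cmod (f x) * cmod (g x))"
proof (rule Bochner_Integration.integrable_bound)
  show "integrable lebesgue (\<lambda>x. (cmod (f x))\<^sup>2 + (cmod (g x))\<^sup>2)"
    using assms by (intro Bochner_Integration.integrable_add L2_integrable)
  show "AE x in lebesgue. norm (cmod (f x) * cmod (g x)) \<le> norm ((cmod (f x))\<^sup>2 + (cmod (g x))\<^sup>2)"
  proof (rule AE_I2)
    fix x
    have "2 * (cmod (f x) * cmod (g x)) \<le> (cmod (f x))\<^sup>2 + (cmod (g x))\<^sup>2"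
      using sum_squares_bound[of "cmod (f x)" "cmod (g x)"] by simp
    moreover have "0 \<le> cmod (f x) * cmod (g x)" by simp
    ultimately have "\<bar>cmod (f x) * cmod (g x)\<bar> \<le> \<bar>(cmod (f x))\<^sup>2 + (cmod (g x))\<^sup>2\<bar>" by linarith
    then show "norm (cmod (f x) * cmod (g x)) \<le> norm ((cmod (f x))\<^sup>2 + (cmod (g x))\<^sup>2)" by simp
  qed
qed (use assms in \<open>auto simp: L2_def\<close>)

lemma L2_mult_integrable:
  assumes "f \<in> L2" "g \<in> L2"
  shows "integrable lebesgue (\<lambda>x. f x * g x)"
  by (rule Bochner_Integration.integrable_bound[OF L2_mult_integrable_norm[OF assms]])
    (use assms in \<open>auto simp: L2_def norm_mult\<close>)

text \<open>The inequality for nonnegative extended integrals carries over to Bochner integrals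
  because the product and both squares are integrable.\<close>

lemma L2_Cauchy_Schwarz_norm:
  assumes "f \<in> L2" "g \<in> L2"
  shows "(\<integral>x. cmod (f x) * cmod (g x) \<partial>lebesgue) \<le> L2_norm f * L2_norm g"
proof -
  have m: "f \<in> borel_measurable lebesgue" "g \<in> borel_measurable lebesgue"
    using assms L2_measurable by auto
  let ?I = "\<integral>x. cmod (f x) * cmod (g x) \<partial>lebesgue"
  have 1: "(\<integral>\<^sup>+x. ennreal (cmod (f x)) * ennreal (cmod (g x)) \<partial>lebesgue) = ennreal ?I"
    using nn_integral_eq_integral[OF L2_mult_integrable_norm[OF assms]]
    by (simp add: ennreal_mult)
  have 2: "(\<integral>\<^sup>+x. (ennreal (cmod (h x)))\<^sup>2 \<partial>lebesgue) = ennreal ((L2_norm h)\<^sup>2)" if "h \<in> L2" for h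
    using nn_integral_eq_integral[OF L2_integrable[OF that]]
    by (simp add: ennreal_power L2_norm_squared)
  have "(ennreal ?I)\<^sup>2 \<le> ennreal ((L2_norm f)\<^sup>2) * ennreal ((L2_norm g)\<^sup>2)"
    using Cauchy_Schwarz_nn_integral[of "\<lambda>x. ennreal (cmod (f x))" lebesgue "\<lambda>x. ennreal (cmod (g x))"] m
    by (simp add: 1 2 assms)
  moreover have "?I \<ge> 0" by simp
  ultimately have "?I\<^sup>2 \<le> (L2_norm f * L2_norm g)\<^sup>2"
    by (simp add: ennreal_power power_mult_distrib flip: ennreal_mult)
  then show ?thesis
    by (rule power2_le_imp_le) simp
qed

text \<open>The pairing is bilinear, without conjugation, to match the definition of weak
  derivatives. Where an inner product is meant, \<open>cnj\<close> is inserted explicitly.\<close>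

lemma L2_Cauchy_Schwarz:
  assumes "f \<in> L2" "g \<in> L2"
  shows "cmod (\<integral>x. f x * g x \<partial>lebesgue) \<le> L2_norm f * L2_norm g"
proof -
  have "cmod (\<integral>x. f x * g x \<partial>lebesgue) \<le> (\<integral>x. cmod (f x) * cmod (g x) \<partial>lebesgue)"
    using integral_norm_bound[of lebesgue "\<lambda>x. f x * g x"] by (simp add: norm_mult)
  then show ?thesis using L2_Cauchy_Schwarz_norm[OF assms] by linarith
qed

lemma L2_add:
  assumes "f \<in> L2" "g \<in> L2"
  shows "(\<lambda>x. f x + g x) \<in> L2" and L2_norm_triangle: "L2_norm (\<lambda>x. f x + g x) \<le> L2_norm f + L2_norm g"
proof -
  let ?h = "\<lambda>x. (cmod (f x))\<^sup>2 + 2 * (cmod (f x) * cmod (g x)) + (cmod (g x))\<^sup>2"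
  have h: "integrable lebesgue ?h"
    using assms by (intro Bochner_Integration.integrable_add integrable_mult_right
        L2_integrable L2_mult_integrable_norm)
  have le: "(cmod (f x + g x))\<^sup>2 \<le> ?h x" for x
  proof -
    have "(cmod (f x + g x))\<^sup>2 \<le> (cmod (f x) + cmod (g x))\<^sup>2"
      by (intro power_mono norm_triangle_ineq) auto
    then show ?thesis by (simp add: power2_sum)
  qed
  have int: "integrable lebesgue (\<lambda>x. (cmod (f x + g x))\<^sup>2)"
  proof (rule Bochner_Integration.integrable_bound[OF h])
    show "AE x in lebesgue. norm ((cmod (f x + g x))\<^sup>2) \<le> norm (?h x)"
      by (rule AE_I2) (use le in \<open>auto intro: order_trans[OF _ abs_ge_self]\<close>)
  qed (use assms in \<open>auto simp: L2_def\<close>)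
  then show "(\<lambda>x. f x + g x) \<in> L2"
    using assms by (auto simp: L2_def)
  have "(\<integral>x. (cmod (f x + g x))\<^sup>2 \<partial>lebesgue) \<le> (\<integral>x. ?h x \<partial>lebesgue)"
    by (rule integral_mono[OF int h le])
  also have "\<dots> = (L2_norm f)\<^sup>2 + 2 * (\<integral>x. cmod (f x) * cmod (g x) \<partial>lebesgue) + (L2_norm g)\<^sup>2"
    using L2_integrable[OF assms(1)] L2_integrable[OF assms(2)] L2_mult_integrable_norm[OF assms]
    by (simp add: L2_norm_squared)
  also have "\<dots> \<le> (L2_norm f + L2_norm g)\<^sup>2"
    using L2_Cauchy_Schwarz_norm[OF assms] by (simp add: power2_sum)
  finally show "L2_norm (\<lambda>x. f x + g x) \<le> L2_norm f + L2_norm g"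
    unfolding L2_norm_squared[symmetric] by (rule power2_le_imp_le) simp
qed

lemma L2_cmult: "f \<in> L2 \<Longrightarrow> (\<lambda>x. c * f x) \<in> L2"
  by (auto simp: L2_def norm_mult power_mult_distrib)

lemma L2_cnj: "f \<in> L2 \<Longrightarrow> (\<lambda>x. cnj (f x)) \<in> L2"
  unfolding L2_def
  using borel_measurable_continuous_onI[OF continuous_on_cnj[OF continuous_on_id]]
  by (auto intro: measurable_compose)

lemma L2_diff: "f \<in> L2 \<Longrightarrow> g \<in> L2 \<Longrightarrow> (\<lambda>x. f x - g x) \<in> L2"
  using L2_add(1)[of f "\<lambda>x. (-1) * g x"] L2_cmult[of g "-1"] by simp

lemma L2_norm_minus_commute: "L2_norm (\<lambda>x. f x - g x) = L2_norm (\<lambda>x. g x - f x)"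
  by (simp add: L2_norm_def norm_minus_commute)

lemma L2_norm_triangle_diff:
  assumes "f \<in> L2" "g \<in> L2" "h \<in> L2"
  shows "L2_norm (\<lambda>x. f x - h x) \<le> L2_norm (\<lambda>x. f x - g x) + L2_norm (\<lambda>x. g x - h x)"
  using L2_norm_triangle[OF L2_diff[OF assms(1,2)] L2_diff[OF assms(2,3)]] by simp

lemma L2_norm_eq_0_iff:
  assumes "f \<in> L2"
  shows "L2_norm f = 0 \<longleftrightarrow> (AE x in lebesgue. f x = 0)"
  using integral_nonneg_eq_0_iff_AE[OF L2_integrable[OF assms]] by (simp add: L2_norm_def)

section \<open>Change of variables and the unitary group of dilations\<close>

lemma integral_lebesgue_dilation:
  fixes f :: "'a::euclidean_space \<Rightarrow> 'b::{banach, second_countable_topology}"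
  assumes c: "c > 0" and f: "integrable lebesgue f"
  shows "integrable lebesgue (\<lambda>x. f (c *\<^sub>R x))"
    and "(\<integral>x. f x \<partial>lebesgue) = c ^ DIM('a) *\<^sub>R (\<integral>x. f (c *\<^sub>R x) \<partial>lebesgue)"
proof -
  have T: "0 + (\<Sum>j\<in>Basis. (c * (x \<bullet> j)) *\<^sub>R j) = c *\<^sub>R x" for x :: 'a
    unfolding scaleR_scaleR[symmetric] scaleR_sum_right[symmetric] euclidean_representation by simp
  \<comment> \<open>In the affine change of variables all factors are \<open>c\<close> and the
    translation is 0, so Lebesgue measure is \<open>c ^ DIM('a)\<close> times its image under
    scaling by \<open>c\<close>.\<close>
  have eq: "lebesgue = density (distr lebesgue lebesgue (\<lambda>x :: 'a. c *\<^sub>R x)) (\<lambda>_. ennreal (c ^ DIM('a)))"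
    using lebesgue_affine_euclidean[of "\<lambda>_ :: 'a. c" 0] c unfolding T by simp
  have m: "f \<in> borel_measurable lebesgue" using f by auto
  have "integrable (density (distr lebesgue lebesgue (\<lambda>x :: 'a. c *\<^sub>R x)) (\<lambda>_. ennreal (c ^ DIM('a)))) f"
    using f eq by simp
  then have "integrable (distr lebesgue lebesgue (\<lambda>x :: 'a. c *\<^sub>R x)) (\<lambda>x. c ^ DIM('a) *\<^sub>R f x)"
    by (subst (asm) integrable_density) (use m c in auto)
  then have "integrable lebesgue (\<lambda>x. c ^ DIM('a) *\<^sub>R f (c *\<^sub>R x))"
    by (subst (asm) integrable_distr_eq) (use m in auto)
  then show "integrable lebesgue (\<lambda>x. f (c *\<^sub>R x))"
    using c integrable_scaleR_right[of "1 / c ^ DIM('a)"] by fastforce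
  have "(\<integral>x. f x \<partial>lebesgue) = (\<integral>x. f x \<partial>density (distr lebesgue lebesgue (\<lambda>x :: 'a. c *\<^sub>R x)) (\<lambda>_. ennreal (c ^ DIM('a))))"
    using eq by simp
  also have "\<dots> = (\<integral>x. c ^ DIM('a) *\<^sub>R f x \<partial>distr lebesgue lebesgue (\<lambda>x :: 'a. c *\<^sub>R x))"
    by (subst integral_density) (use m c in auto)
  also have "\<dots> = (\<integral>x. c ^ DIM('a) *\<^sub>R f (c *\<^sub>R x) \<partial>lebesgue)"
    by (subst integral_distr) (use m in auto)
  finally show "(\<integral>x. f x \<partial>lebesgue) = c ^ DIM('a) *\<^sub>R (\<integral>x. f (c *\<^sub>R x) \<partial>lebesgue)" by simp
qed

text \<open>The prefactor is the square root of the Jacobian \<open>exp t ^ CARD('n)\<close>, which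
  preserves the L2 norm. The exponential parameter makes composition additive in
  \<open>t\<close>.\<close>

definition dilate :: "real \<Rightarrow> (real ^ 'n \<Rightarrow> complex) \<Rightarrow> real ^ 'n \<Rightarrow> complex" where
  "dilate t f = (\<lambda>x. of_real (exp (real CARD('n) / 2 * t)) * f (exp t *\<^sub>R x))"

lemma dilate_L2:
  fixes f :: "real ^ 'n \<Rightarrow> complex"
  assumes "f \<in> L2"
  shows "dilate t f \<in> L2" and L2_norm_dilate: "L2_norm (dilate t f) = L2_norm f"
proof -
  have sq: "(cmod (dilate t f x))\<^sup>2 = exp t ^ CARD('n) * (cmod (f (exp t *\<^sub>R x)))\<^sup>2" for x
    by (simp add: dilate_def norm_mult power_mult_distrib flip: exp_of_nat_mult)
  note d = integral_lebesgue_dilation[OF exp_gt_zero[of t] L2_integrable[OF assms]]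
  have "dilate t f \<in> borel_measurable lebesgue"
    using measurable_compose[OF lebesgue_measurable_scaling[of "exp t"] L2_measurable[OF assms]]
    unfolding dilate_def by simp
  then show "dilate t f \<in> L2"
    using d(1) by (auto simp: L2_def sq)
  show "L2_norm (dilate t f) = L2_norm f"
    using d(2) by (simp add: L2_norm_def sq)
qed

lemma dilate_diff: "dilate t (\<lambda>x. f x - g x) = (\<lambda>x. dilate t f x - dilate t g x)"
  by (simp add: dilate_def algebra_simps)

lemma dilate_dilate: "dilate s (dilate t f) = dilate (s + t) f"
  by (auto simp: dilate_def fun_eq_iff exp_add add_divide_distrib algebra_simps)

lemma dilate_0 [simp]: "dilate 0 f = f"
  by (simp add: dilate_def)

section \<open>Density of the test functions\<close>

text \<open>By Heine-Borel the closure of the support is compact exactly when the support is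
  bounded, and a radius is easier to follow through dilations and derivatives.\<close>

lemma test_functions_iff:
  "\<eta> \<in> test_functions \<longleftrightarrow> smooth \<eta> \<and> (\<exists>R. \<forall>x. \<eta> x \<noteq> 0 \<longrightarrow> norm x \<le> R)"
  unfolding test_functions_def by (auto simp: bounded_iff)

lemma test_functionI:
  "smooth \<eta> \<Longrightarrow> (\<And>x. \<eta> x \<noteq> 0 \<Longrightarrow> norm x \<le> R) \<Longrightarrow> \<eta> \<in> test_functions"
  using test_functions_iff by blast

lemma test_function_smooth: "\<eta> \<in> test_functions \<Longrightarrow> smooth \<eta>"
  by (simp add: test_functions_iff)

lemma test_function_mult:
  "smooth f \<Longrightarrow> \<eta> \<in> test_functions \<Longrightarrow> (\<lambda>x. f x * \<eta> x) \<in> test_functions"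
  by (auto simp: test_functions_iff intro: smooth_mult)

lemma test_function_dilate:
  assumes "\<eta> \<in> test_functions"
  shows "dilate t \<eta> \<in> test_functions"
proof -
  obtain R where R: "\<And>x. \<eta> x \<noteq> 0 \<Longrightarrow> norm x \<le> R" and sm: "smooth \<eta>"
    using assms test_functions_iff by blast
  show ?thesis
  proof (rule test_functionI)
    show "smooth (dilate t \<eta>)"
      unfolding dilate_def by (intro smooth_mult smooth_const smooth_dilation sm)
    show "norm x \<le> R / exp t" if "dilate t \<eta> x \<noteq> 0" for x
      using R[of "exp t *\<^sub>R x"] that by (auto simp: dilate_def field_simps)
  qed
qed

lemma test_function_partial_deriv:
  assumes "\<eta> \<in> test_functions"
  shows "partial_deriv j \<eta> \<in> test_functions"
proof -
  obtain R where R: "\<And>x. \<eta> x \<noteq> 0 \<Longrightarrow> norm x \<le> R" and sm: "smooth \<eta>"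
    using assms test_functions_iff by blast
  show ?thesis
  proof (rule test_functionI)
    show "smooth (partial_deriv j \<eta>)" using sm by (rule smooth_partial_deriv)
    fix x assume nz: "partial_deriv j \<eta> x \<noteq> 0"
    show "norm x \<le> R"
    \<comment> \<open>Outside the closed ball \<open>\<eta>\<close> vanishes on an open set, so its
      derivative vanishes there as well.\<close>
    proof (rule ccontr)
      assume "\<not> norm x \<le> R"
      then have x: "x \<in> - cball 0 R" by simp
      have "((\<lambda>x. 0) has_derivative (\<lambda>h. 0)) (at x)" by simp
      then have "(\<eta> has_derivative (\<lambda>h. 0)) (at x)"
        by (rule has_derivative_transform_within_open[OF _ open_Compl[OF closed_cball] x])
          (use R in fastforce)
      then show False
        using nz frechet_derivative_at unfolding partial_deriv_def by metis
    qed
  qed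
qed

lemma test_function_bounded:
  assumes "\<eta> \<in> test_functions"
  shows "\<exists>M. \<forall>x. cmod (\<eta> x) \<le> M"
proof -
  obtain R where R: "\<And>x. \<eta> x \<noteq> 0 \<Longrightarrow> norm x \<le> R" and sm: "smooth \<eta>"
    using assms test_functions_iff by blast
  have "bounded (\<eta> ` cball 0 R)"
    by (intro compact_imp_bounded compact_continuous_image smooth_continuous_on sm) auto
  then obtain M where "\<And>x. norm x \<le> R \<Longrightarrow> cmod (\<eta> x) \<le> M"
    unfolding bounded_iff by (metis imageI mem_cball_0)
  then have "cmod (\<eta> x) \<le> max M 0" for x
    using R[of x] by (cases "\<eta> x = 0") (auto simp: max.coboundedI1)
  then show ?thesis by blast
qed

text \<open>The norm estimate turns a uniform approximation on a ball into an approximation in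
  L2.\<close>

lemma L2_bounded_support:
  fixes f :: "real ^ 'n \<Rightarrow> complex"
  assumes m: "f \<in> borel_measurable lebesgue"
    and M: "\<And>x. cmod (f x) \<le> M" and R: "\<And>x. f x \<noteq> 0 \<Longrightarrow> norm x \<le> R"
  shows "f \<in> L2" and "L2_norm f \<le> M * sqrt (measure lebesgue (cball (0 :: real ^ 'n) R))"
proof -
  have M0: "0 \<le> M" using M[of 0] norm_ge_zero order_trans by blast
  let ?g = "\<lambda>x :: real ^ 'n. M\<^sup>2 * indicator (cball 0 R) x"
  have fin: "emeasure lebesgue (cball (0 :: real ^ 'n) R) < \<infinity>"
    by (metis fmeasurableD2 infinity_ennreal_def lmeasurable_cball top.not_eq_extremum)
  have g: "integrable lebesgue ?g"
    using fin by (intro integrable_mult_right integrable_real_indicator) auto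
  have le: "(cmod (f x))\<^sup>2 \<le> ?g x" for x
    using M[of x] R[of x] by (cases "f x = 0") (auto simp: power_mono)
  have int: "integrable lebesgue (\<lambda>x. (cmod (f x))\<^sup>2)"
    by (rule Bochner_Integration.integrable_bound[OF g])
      (use le m in \<open>auto intro!: AE_I2 order_trans[OF _ abs_ge_self]\<close>)
  then show "f \<in> L2" using m by (simp add: L2_def)
  have "(\<integral>x. (cmod (f x))\<^sup>2 \<partial>lebesgue) \<le> M\<^sup>2 * measure lebesgue (cball (0 :: real ^ 'n) R)"
    using integral_mono[OF int g le] by simp
  then have "L2_norm f \<le> sqrt (M\<^sup>2 * measure lebesgue (cball (0 :: real ^ 'n) R))"
    unfolding L2_norm_def by (rule real_sqrt_le_mono)
  then show "L2_norm f \<le> M * sqrt (measure lebesgue (cball (0 :: real ^ 'n) R))"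
    using M0 by (simp add: real_sqrt_mult)
qed

lemma smooth_measurable: "smooth f \<Longrightarrow> f \<in> borel_measurable lebesgue"
  by (auto intro!: measurable_completion borel_measurable_continuous_onI smooth_continuous_on)

lemma test_function_L2:
  assumes "\<eta> \<in> test_functions"
  shows "\<eta> \<in> L2"
  using L2_bounded_support(1)[of \<eta>] test_function_bounded[OF assms] assms
  unfolding test_functions_iff by (blast intro: smooth_measurable)

text \<open>Dominated convergence for the squared differences with majorant
  \<open>(cmod (g x))\<^sup>2\<close>. The bound is placed on the differences, since for truncations
  of \<open>f\<close> it is then given by \<open>f\<close> itself.\<close>

lemma L2_norm_tendsto_0:
  fixes f :: "real ^ 'n \<Rightarrow> complex"
  assumes f: "f \<in> borel_measurable lebesgue" and s: "\<And>k. s k \<in> borel_measurable lebesgue"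
    and g: "g \<in> L2" and dom: "\<And>k x. cmod (f x - s k x) \<le> cmod (g x)"
    and lim: "AE x in lebesgue. (\<lambda>k. s k x) \<longlonglongrightarrow> f x"
  shows "(\<lambda>k. L2_norm (\<lambda>x. f x - s k x)) \<longlonglongrightarrow> 0"
proof -
  have "(\<lambda>k. \<integral>x. (cmod (f x - s k x))\<^sup>2 \<partial>lebesgue) \<longlonglongrightarrow> (\<integral>x. 0 \<partial>(lebesgue :: (real ^ 'n) measure))"
  proof (rule integral_dominated_convergence[where w = "\<lambda>x. (cmod (g x))\<^sup>2"])
    show "AE x in lebesgue. (\<lambda>k. (cmod (f x - s k x))\<^sup>2) \<longlonglongrightarrow> 0"
      using lim
    proof eventually_elim
      case (elim x)
      have "(\<lambda>k. (cmod (f x - s k x))\<^sup>2) \<longlonglongrightarrow> (cmod (f x - f x))\<^sup>2"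
        by (intro tendsto_intros elim)
      then show ?case by simp
    qed
    show "AE x in lebesgue. norm ((cmod (f x - s k x))\<^sup>2) \<le> (cmod (g x))\<^sup>2" for k
      using dom by (intro AE_I2) (simp add: power_mono)
  qed (use f s L2_integrable[OF g] in auto)
  from tendsto_real_sqrt[OF this] show ?thesis by (simp add: L2_norm_def)
qed

text \<open>Membership in the L2 closure of the test functions. The closure is enlarged in stages:
  smooth functions cut off to a ball, continuous functions cut off to a ball, bounded measurable
  functions with bounded support, and finally all of \<open>L2\<close>.\<close>

definition approximable :: "(real ^ 'n \<Rightarrow> complex) \<Rightarrow> bool" where
  "approximable f \<longleftrightarrow> f \<in> L2 \<and> (\<forall>\<epsilon>>0. \<exists>\<eta>\<in>test_functions. L2_norm (\<lambda>x. f x - \<eta> x) < \<epsilon>)"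

lemma approximable_closed:
  assumes f: "f \<in> L2"
    and *: "\<And>\<epsilon>. \<epsilon> > 0 \<Longrightarrow> \<exists>g. approximable g \<and> L2_norm (\<lambda>x. f x - g x) < \<epsilon>"
  shows "approximable f"
  unfolding approximable_def
proof (intro conjI f allI impI)
  fix \<epsilon> :: real assume "\<epsilon> > 0"
  then obtain g where g: "approximable g" "L2_norm (\<lambda>x. f x - g x) < \<epsilon> / 2"
    using *[of "\<epsilon> / 2"] by auto
  then obtain \<eta> where \<eta>: "\<eta> \<in> test_functions" "L2_norm (\<lambda>x. g x - \<eta> x) < \<epsilon> / 2"
    using \<open>\<epsilon> > 0\<close> unfolding approximable_def by (meson half_gt_zero)
  have "L2_norm (\<lambda>x. f x - \<eta> x) \<le> L2_norm (\<lambda>x. f x - g x) + L2_norm (\<lambda>x. g x - \<eta> x)"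
    using L2_norm_triangle_diff f g(1) \<eta>(1) test_function_L2 unfolding approximable_def by blast
  then show "\<exists>\<eta>\<in>test_functions. L2_norm (\<lambda>x. f x - \<eta> x) < \<epsilon>"
    using g(2) \<eta> by (intro bexI[of _ \<eta>]) auto
qed

lemma approximable_limit:
  assumes "f \<in> L2" "\<And>k. approximable (s k)"
    and "(\<lambda>k :: nat. L2_norm (\<lambda>x. f x - s k x)) \<longlonglongrightarrow> 0"
  shows "approximable f"
proof (rule approximable_closed[OF assms(1)])
  fix \<epsilon> :: real assume "\<epsilon> > 0"
  then have "\<forall>\<^sub>F k in sequentially. L2_norm (\<lambda>x. f x - s k x) < \<epsilon>"
    using order_tendstoD(2)[OF assms(3)] by blast
  then show "\<exists>g. approximable g \<and> L2_norm (\<lambda>x. f x - g x) < \<epsilon>"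
    using assms(2) eventually_happens'[OF sequentially_bot] by blast
qed

lemma test_function_approximable:
  assumes "\<eta> \<in> test_functions" shows "approximable \<eta>"
proof -
  have "L2_norm (\<lambda>x. \<eta> x - \<eta> x) = 0" by (simp add: L2_norm_def)
  then show ?thesis using assms test_function_L2[OF assms] unfolding approximable_def by metis
qed

lemma continuous_ball_L2:
  fixes h :: "real ^ 'n \<Rightarrow> complex"
  assumes "continuous_on UNIV h"
  shows "(\<lambda>x. if norm x < R then h x else 0) \<in> L2"
proof -
  have "bounded (h ` cball 0 R)"
    by (intro compact_imp_bounded compact_continuous_image continuous_on_subset[OF assms]) auto
  then obtain M where M: "\<And>x. norm x \<le> R \<Longrightarrow> cmod (h x) \<le> M"
    unfolding bounded_iff by (metis imageI mem_cball_0)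
  have [measurable]: "h \<in> borel_measurable lborel"
    using borel_measurable_continuous_onI[OF assms] by simp
  have "(\<lambda>x. if norm x < R then h x else 0) \<in> borel_measurable lborel"
    by measurable
  then have "(\<lambda>x. if norm x < R then h x else 0) \<in> borel_measurable lebesgue"
    by (rule measurable_completion)
  then show ?thesis
    by (rule L2_bounded_support(1)[where M = "max M 0" and R = R])
      (use M in \<open>auto simp: max.coboundedI1 split: if_splits\<close>)
qed

lemma smooth_ball_approximable:
  fixes p :: "real ^ 'n \<Rightarrow> complex"
  assumes p: "smooth p" and R: "R > 0"
  shows "approximable (\<lambda>x. if norm x < R then p x else 0)" (is "approximable ?f")
proof -
  \<comment> \<open>As \<open>c \<rightarrow> 0\<close>, the bump \<open>exp (- c / (R\<^sup>2 - \<bar>x\<bar>\<^sup>2))\<close> increases to the indicator of the ball.\<close>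
  define s where "s k x = p x * of_real (bump (inverse (Suc k)) 0 (R\<^sup>2 - x \<bullet> x))"
    for k and x :: "real ^ 'n"
  have s: "s k \<in> test_functions" for k
  proof (rule test_functionI)
    show "smooth (s k)"
      unfolding s_def by (intro smooth_mult p smooth_bump_quad) simp
    show "norm x \<le> R" if "s k x \<noteq> 0" for x
    proof -
      have "(norm x)\<^sup>2 < R\<^sup>2"
        using that by (auto simp: s_def bump_def dot_square_norm split: if_splits)
      then show ?thesis using R power2_less_imp_less[of "norm x" R] by simp
    qed
  qed
  have f: "?f \<in> L2" using p by (intro continuous_ball_L2 smooth_continuous_on)
  have iff: "R\<^sup>2 - x \<bullet> x > 0 \<longleftrightarrow> norm x < R" for x :: "real ^ 'n"
    using R power_strict_mono[of "norm x" R 2] power2_less_imp_less[of "norm x" R]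
    unfolding dot_square_norm by auto
  show ?thesis
  proof (rule approximable_limit[OF f test_function_approximable[OF s]])
    show "(\<lambda>k. L2_norm (\<lambda>x. ?f x - s k x)) \<longlonglongrightarrow> 0"
    proof (rule L2_norm_tendsto_0[OF _ _ f])
      show "AE x in lebesgue. (\<lambda>k. s k x) \<longlonglongrightarrow> ?f x"
      proof (rule AE_I2)
        fix x :: "real ^ 'n"
        show "(\<lambda>k. s k x) \<longlonglongrightarrow> ?f x"
        proof (cases "norm x < R")
          case True
          have "(\<lambda>k. p x * of_real (exp (- (inverse (real (Suc k)) / (R\<^sup>2 - x \<bullet> x))))) \<longlonglongrightarrow>
            p x * of_real (exp (- (0 / (R\<^sup>2 - x \<bullet> x))))"
            by (intro tendsto_mult tendsto_const tendsto_of_real tendsto_exp tendsto_minus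
                tendsto_divide LIMSEQ_inverse_real_of_nat) (use iff[of x] True in auto)
          then show ?thesis using iff[of x] True by (simp add: s_def bump_def)
        qed (use iff[of x] in \<open>simp add: s_def bump_def\<close>)
      qed
      fix k x
      show "cmod (?f x - s k x) \<le> cmod (?f x)"
      proof (cases "norm x < R")
        case True
        let ?b = "bump (inverse (Suc k)) 0 (R\<^sup>2 - x \<bullet> x)"
        \<comment> \<open>With exponent \<open>m = 0\<close> the bump takes values between 0 and 1,
          so damping by it never moves \<open>p\<close> by more than \<open>p\<close>
          itself.\<close>
        have b: "0 \<le> ?b" "?b \<le> 1" using iff[of x] True by (auto simp: bump_def)
        have "?f x - s k x = p x * of_real (1 - ?b)"
          using True by (simp add: s_def algebra_simps)
        also have "cmod \<dots> = cmod (p x) * (1 - ?b)"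
          using b by (simp only: norm_mult norm_of_real)
        also have "\<dots> \<le> cmod (p x) * 1" using b by (intro mult_left_mono) auto
        finally show ?thesis using True by simp
      qed (use iff[of x] in \<open>simp add: s_def bump_def\<close>)
    qed (rule L2_measurable[OF f], rule L2_measurable[OF test_function_L2[OF s]])
  qed
qed

text \<open>Real functions with smooth complexification form an algebra that contains the constants
  and separates points through the coordinates. Stone-Weierstrass is applied to the real and the
  imaginary part, each with half the error.\<close>

lemma Stone_Weierstrass_smooth:
  fixes h :: "real ^ 'n \<Rightarrow> complex"
  assumes h: "continuous_on UNIV h" and \<epsilon>: "\<epsilon> > 0"
  shows "\<exists>p. smooth p \<and> (\<forall>x\<in>cball 0 R. cmod (h x - p x) < \<epsilon>)"
proof -
  have *: "\<exists>g. smooth (\<lambda>x. complex_of_real (g x)) \<and> (\<forall>x\<in>cball 0 R. \<bar>f x - g x\<bar> < \<epsilon> / 2)"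
    if f: "continuous_on (cball 0 R) f" for f :: "real ^ 'n \<Rightarrow> real"
  proof (rule Stone_Weierstrass_HOL[where P = "\<lambda>g. smooth (\<lambda>x. complex_of_real (g x))"])
    show "continuous_on (cball 0 R) g" if "smooth (\<lambda>x. complex_of_real (g x))" for g :: "real ^ 'n \<Rightarrow> real"
      using continuous_on_Re[OF smooth_continuous_on[OF that]] by simp
    show "\<exists>f. smooth (\<lambda>x. complex_of_real (f x)) \<and> f x \<noteq> f y"
      if xy: "x \<in> cball 0 R \<and> y \<in> cball 0 R \<and> x \<noteq> y" for x y :: "real ^ 'n"
    proof -
      obtain i where "x $ i \<noteq> y $ i" using xy unfolding vec_eq_iff by blast
      then show ?thesis by (intro exI[of _ "\<lambda>x. x $ i"]) simp
    qed
  qed (use f \<epsilon> in \<open>auto intro: smooth_add smooth_mult\<close>)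
  obtain g1 where g1: "smooth (\<lambda>x. complex_of_real (g1 x))" "\<forall>x\<in>cball 0 R. \<bar>Re (h x) - g1 x\<bar> < \<epsilon> / 2"
    using *[of "\<lambda>x. Re (h x)"] continuous_on_Re[OF continuous_on_subset[OF h]] by auto
  obtain g2 where g2: "smooth (\<lambda>x. complex_of_real (g2 x))" "\<forall>x\<in>cball 0 R. \<bar>Im (h x) - g2 x\<bar> < \<epsilon> / 2"
    using *[of "\<lambda>x. Im (h x)"] continuous_on_Im[OF continuous_on_subset[OF h]] by auto
  show ?thesis
  proof (intro exI conjI ballI)
    show "smooth (\<lambda>x. complex_of_real (g1 x) + \<i> * complex_of_real (g2 x))"
      using g1 g2 by (intro smooth_add smooth_mult) auto
    fix x :: "real ^ 'n" assume "x \<in> cball 0 R"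
    then have "\<bar>Re (h x) - g1 x\<bar> < \<epsilon> / 2" "\<bar>Im (h x) - g2 x\<bar> < \<epsilon> / 2" using g1 g2 by auto
    then show "cmod (h x - (complex_of_real (g1 x) + \<i> * complex_of_real (g2 x))) < \<epsilon>"
      using cmod_le[of "h x - (complex_of_real (g1 x) + \<i> * complex_of_real (g2 x))"] by simp
  qed
qed

lemma continuous_ball_approximable:
  fixes h :: "real ^ 'n \<Rightarrow> complex"
  assumes h: "continuous_on UNIV h" and R: "R > 0"
  shows "approximable (\<lambda>x. if norm x < R then h x else 0)" (is "approximable ?f")
proof (rule approximable_closed)
  show "?f \<in> L2" using h by (rule continuous_ball_L2)
  fix \<epsilon> :: real assume "\<epsilon> > 0"
  define V where "V = sqrt (measure lebesgue (cball (0 :: real ^ 'n) R))"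
  have V: "V \<ge> 0" by (simp add: V_def)
  \<comment> \<open>A uniform error \<open>\<delta>\<close> on the ball costs at most
    \<open>\<delta> * V\<close> in L2. The summand 1 makes this strictly less than
    \<open>\<epsilon>\<close> and excludes division by 0.\<close>
  define \<delta> where "\<delta> = \<epsilon> / (V + 1)"
  have \<delta>: "\<delta> > 0" "\<delta> * V < \<epsilon>"
    using \<open>\<epsilon> > 0\<close> V by (auto simp: \<delta>_def field_simps)
  obtain p where p: "smooth p" "\<forall>x\<in>cball 0 R. cmod (h x - p x) < \<delta>"
    using Stone_Weierstrass_smooth[OF h \<delta>(1)] by blast
  let ?g = "\<lambda>x. if norm x < R then p x else 0"
  have g: "approximable ?g" using p(1) R by (rule smooth_ball_approximable)
  have "L2_norm (\<lambda>x. ?f x - ?g x) \<le> \<delta> * V"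
    unfolding V_def
  proof (rule L2_bounded_support(2))
    show "(\<lambda>x. ?f x - ?g x) \<in> borel_measurable lebesgue"
      using \<open>?f \<in> L2\<close> g unfolding approximable_def
      by (intro borel_measurable_diff L2_measurable) auto
    show "cmod (?f x - ?g x) \<le> \<delta>" for x
      using p(2) \<delta>(1) by (auto intro: less_imp_le)
    show "norm x \<le> R" if "?f x - ?g x \<noteq> 0" for x
      using that by (auto split: if_splits)
  qed
  then show "\<exists>g. approximable g \<and> L2_norm (\<lambda>x. ?f x - g x) < \<epsilon>"
    using g \<delta>(2) by (intro exI[of _ ?g]) auto
qed

text \<open>A Lebesgue measurable function is almost everywhere a limit of continuous functions.
  Clipping these to the disc of radius \<open>M\<close> and cutting off to the ball restores the
  uniform bound that dominated convergence requires.\<close>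

lemma bounded_support_approximable:
  fixes f :: "real ^ 'n \<Rightarrow> complex"
  assumes m: "f \<in> borel_measurable lebesgue" and M: "\<And>x. cmod (f x) \<le> M"
    and R: "\<And>x. f x \<noteq> 0 \<Longrightarrow> norm x < R" "R > 0"
  shows "approximable f"
proof -
  have M0: "0 \<le> M" using M[of 0] norm_ge_zero order_trans by blast
  obtain N g where N: "negligible N" and g: "\<And>n :: nat. continuous_on UNIV (g n)"
    and lim: "\<And>x. x \<notin> N \<Longrightarrow> (\<lambda>n. g n x) \<longlonglongrightarrow> f x"
    using lebesgue_measurable_imp_measurable_on[OF m, of UNIV] unfolding measurable_on_def by auto
  \<comment> \<open>The nearest-point projection onto the disc is continuous and fixes all values of
    \<open>f\<close>, so clipping preserves the pointwise limit.\<close>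
  define clip where "clip = closest_point (cball (0 :: complex) M)"
  have clip: "continuous_on UNIV clip" "\<And>z. cmod z \<le> M \<Longrightarrow> clip z = z" "\<And>z. cmod (clip z) \<le> M"
    unfolding clip_def using M0 closest_point_in_set[of "cball (0 :: complex) M"]
    by (auto intro!: continuous_on_closest_point closest_point_self simp: mem_cball_0)
  define s where "s k x = (if norm x < R then clip (g k x) else 0)" for k x
  have cont: "continuous_on UNIV (\<lambda>x. clip (g k x))" for k
    by (rule continuous_on_compose2[OF clip(1) g]) auto
  have s: "approximable (s k)" for k
    unfolding s_def using cont R(2) by (rule continuous_ball_approximable)
  have f: "f \<in> L2"
    by (rule L2_bounded_support(1)[OF m M]) (use R in \<open>auto intro: less_imp_le\<close>)
  show ?thesis
  proof (rule approximable_limit[OF f s])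
    show "(\<lambda>k. L2_norm (\<lambda>x. f x - s k x)) \<longlonglongrightarrow> 0"
    proof (rule L2_norm_tendsto_0[OF m])
      show "s k \<in> borel_measurable lebesgue" for k
        using s L2_measurable unfolding approximable_def by blast
      show "(\<lambda>x. if norm x < R then of_real (2 * M) else 0) \<in> L2"
        by (rule continuous_ball_L2) simp
      show "cmod (f x - s k x) \<le> cmod (if norm x < R then of_real (2 * M) else 0)" for k x
      proof (cases "norm x < R")
        case True
        have "cmod (f x - s k x) \<le> cmod (f x) + cmod (clip (g k x))"
          using True by (simp add: s_def norm_triangle_ineq4)
        then show ?thesis using True M[of x] clip(3)[of "g k x"] M0 by simp
      next
        case False
        then have "f x = 0" using R(1) by blast
        with False show ?thesis by (simp add: s_def)
      qed
      have "AE x in lebesgue. x \<notin> N"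
        using N negligible_iff_null_sets AE_not_in by blast
      then show "AE x in lebesgue. (\<lambda>k. s k x) \<longlonglongrightarrow> f x"
      proof eventually_elim
        case (elim x)
        show ?case
        proof (cases "norm x < R")
          case True
          have "isCont clip (f x)" using clip(1) continuous_on_eq_continuous_at by blast
          then have "(\<lambda>k. clip (g k x)) \<longlonglongrightarrow> clip (f x)"
            using lim[OF elim] by (rule isCont_tendsto_compose)
          then show ?thesis using True clip(2)[OF M] by (simp add: s_def)
        next
          case False
          then have "f x = 0" using R(1) by blast
          with False show ?thesis by (simp add: s_def)
        qed
      qed
    qed
  qed
qed

lemma test_functions_dense:
  assumes f: "f \<in> L2"
  shows "approximable f"
proof -
  \<comment> \<open>Both the domain and the values are truncated. \<open>Suc k\<close> keeps the
    radius positive also for \<open>k = 0\<close>.\<close>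
  define s where "s k x = (if norm x < real (Suc k) \<and> cmod (f x) \<le> real k then f x else 0)" for k x
  have [measurable]: "f \<in> borel_measurable lebesgue" using f by (rule L2_measurable)
  have "(\<lambda>x. norm x) \<in> borel_measurable lebesgue"
    by (intro borel_measurable_norm measurable_completion) auto
  then have m: "s k \<in> borel_measurable lebesgue" for k
    unfolding s_def by measurable
  have "approximable (s k)" for k
    by (rule bounded_support_approximable[OF m, where M = "real k" and R = "real (Suc k)"])
      (auto simp: s_def split: if_splits)
  then show ?thesis
  proof (rule approximable_limit[OF f])
    show "(\<lambda>k. L2_norm (\<lambda>x. f x - s k x)) \<longlonglongrightarrow> 0"
    proof (rule L2_norm_tendsto_0[OF _ m f])
      show "cmod (f x - s k x) \<le> cmod (f x)" for k x by (simp add: s_def)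
      show "AE x in lebesgue. (\<lambda>k. s k x) \<longlonglongrightarrow> f x"
      proof (rule AE_I2, rule tendsto_eventually)
        fix x
        obtain K :: nat where K: "max (norm x) (cmod (f x)) \<le> real K" using real_arch_simple by blast
        show "\<forall>\<^sub>F k in sequentially. s k x = f x"
          using eventually_ge_at_top[of K]
        proof eventually_elim
          case (elim k)
          then have "real K \<le> real k" by simp
          then show ?case using K unfolding s_def by simp
        qed
      qed
    qed simp
  qed
qed

section \<open>The generator of the dilations\<close>

text \<open>Derivatives of integrals are obtained below from dominated convergence, which acts on
  difference quotients.\<close>

lemma has_vector_derivative_at_iff_quotient:
  "(f has_vector_derivative D) (at x) \<longleftrightarrow> ((\<lambda>h. (f (x + h) - f x) /\<^sub>R h) \<longlongrightarrow> D) (at 0)"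
proof -
  have "norm (f (x + h) - f x - h *\<^sub>R D) / norm h = norm ((f (x + h) - f x) /\<^sub>R h - D)" if "h \<noteq> 0" for h
  proof -
    have "(f (x + h) - f x) /\<^sub>R h - D = (f (x + h) - f x - h *\<^sub>R D) /\<^sub>R h"
      using that by (simp add: scaleR_diff_right)
    then show ?thesis by (simp add: divide_inverse mult.commute)
  qed
  then have "((\<lambda>h. norm (f (x + h) - f x - h *\<^sub>R D) / norm h) \<longlongrightarrow> 0) (at 0) \<longleftrightarrow>
    ((\<lambda>h. norm ((f (x + h) - f x) /\<^sub>R h - D)) \<longlongrightarrow> 0) (at 0)"
    by (intro filterlim_cong) (auto simp: eventually_at_filter)
  then show ?thesis
    by (simp only: has_vector_derivative_def has_derivative_at bounded_linear_scaleR_left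
        tendsto_norm_zero_iff LIM_zero_iff simp_thms)
qed

text \<open>The operator \<open>x \<cdot> \<nabla> + n/2\<close>, in divergence form so that weak derivatives can be moved directly.\<close>

definition generator :: "(real ^ 'n \<Rightarrow> complex) \<Rightarrow> real ^ 'n \<Rightarrow> complex" where
  "generator \<eta> = (\<lambda>x. (\<Sum>j\<in>UNIV. partial_deriv j (\<lambda>x. of_real (x $ j) * \<eta> x) x)
     - of_real (real CARD('n) / 2) * \<eta> x)"

text \<open>Expanding the divergence by the Leibniz rule produces \<eta> once for each coordinate;
  subtracting n/2 leaves n/2. The remaining sum is the derivative of \<eta> at \<open>x\<close> in
  the direction \<open>x\<close>, by linearity.\<close>

lemma generator_eq:
  fixes \<eta> :: "real ^ 'n \<Rightarrow> complex"
  assumes "smooth \<eta>"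
  shows "generator \<eta> x = of_real (real CARD('n) / 2) * \<eta> x + frechet_derivative \<eta> (at x) x"
proof -
  have lin: "linear (frechet_derivative \<eta> (at x))"
    using linear_frechet_derivative[OF smooth_differentiable[OF assms]] .
  have "frechet_derivative \<eta> (at x) x = frechet_derivative \<eta> (at x) (\<Sum>j\<in>UNIV. (x $ j) *\<^sub>R axis j 1)"
    by (simp add: basis_expansion flip: scalar_mult_eq_scaleR)
  also have "\<dots> = (\<Sum>j\<in>UNIV. of_real (x $ j) * partial_deriv j \<eta> x)"
    by (simp add: linear_sum[OF lin] linear_scale[OF lin] partial_deriv_def
        flip: scaleR_conv_of_real)
  finally show ?thesis
    by (simp add: generator_def partial_deriv_mult smooth_differentiable[OF assms]
        smooth_differentiable[OF smooth_component] partial_deriv_component sum.distrib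
        algebra_simps)
qed

lemma test_function_generator_bounded:
  assumes "\<eta> \<in> test_functions"
  shows "\<exists>M. \<forall>x. cmod (generator \<eta> x) \<le> M"
proof -
  have "\<forall>j. \<exists>M. \<forall>x. cmod (partial_deriv j (\<lambda>x. of_real (x $ j) * \<eta> x) x) \<le> M"
    using test_function_bounded test_function_partial_deriv test_function_mult[OF smooth_component assms]
    by blast
  then obtain M where M: "\<And>j x. cmod (partial_deriv j (\<lambda>x. of_real (x $ j) * \<eta> x) x) \<le> M j"
    by metis
  obtain K where K: "\<And>x. cmod (\<eta> x) \<le> K" using test_function_bounded[OF assms] by blast
  have "cmod (generator \<eta> x) \<le> (\<Sum>j\<in>UNIV. M j) + real CARD('a) / 2 * K" for x
    unfolding generator_def
    by (intro order_trans[OF norm_triangle_ineq4] add_mono sum_norm_le M)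
      (auto simp: norm_mult intro!: mult_left_mono K)
  then show ?thesis by blast
qed

text \<open>The curve \<open>exp t *\<^sub>R x\<close> has its own position as velocity, so the
  chain rule yields the radial derivative at that point, and the prefactor contributes the term with
  n/2.\<close>

lemma dilate_has_vector_derivative:
  fixes \<eta> :: "real ^ 'n \<Rightarrow> complex"
  assumes "smooth \<eta>"
  shows "((\<lambda>t. dilate t \<eta> x) has_vector_derivative dilate t (generator \<eta>) x) (at t)"
proof -
  let ?c = "real CARD('n) / 2" and ?D = "frechet_derivative \<eta> (at (exp t *\<^sub>R x))"
  have lin: "linear ?D"
    using linear_frechet_derivative[OF smooth_differentiable[OF assms]] .
  have 1: "((\<lambda>t. \<eta> (exp t *\<^sub>R x)) has_derivative (\<lambda>h. ?D ((exp t * h) *\<^sub>R x))) (at t)"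
    by (rule has_derivative_compose[OF _ smooth_has_derivative[OF assms], of "\<lambda>t. exp t *\<^sub>R x"])
      (auto intro!: derivative_eq_intros)
  have 2: "((\<lambda>t. complex_of_real (exp (?c * t))) has_derivative (\<lambda>h. of_real (?c * exp (?c * t) * h))) (at t)"
    by (intro has_derivative_of_real) (auto intro!: derivative_eq_intros)
  have "((\<lambda>t. dilate t \<eta> x) has_derivative
     (\<lambda>h. of_real (exp (?c * t)) * ?D ((exp t * h) *\<^sub>R x) +
        of_real (?c * exp (?c * t) * h) * \<eta> (exp t *\<^sub>R x))) (at t)"
    unfolding dilate_def using has_derivative_mult[OF 2 1] .
  moreover have "(\<lambda>h. of_real (exp (?c * t)) * ?D ((exp t * h) *\<^sub>R x) +
        of_real (?c * exp (?c * t) * h) * \<eta> (exp t *\<^sub>R x)) = (\<lambda>h. h *\<^sub>R dilate t (generator \<eta>) x)"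
  proof
    fix h
    have "?D ((exp t * h) *\<^sub>R x) = h *\<^sub>R ?D (exp t *\<^sub>R x)"
      by (simp add: mult.commute flip: linear_scale[OF lin])
    then show "of_real (exp (?c * t)) * ?D ((exp t * h) *\<^sub>R x) +
        of_real (?c * exp (?c * t) * h) * \<eta> (exp t *\<^sub>R x) = h *\<^sub>R dilate t (generator \<eta>) x"
      unfolding dilate_def generator_eq[OF assms]
      by (simp add: scaleR_conv_of_real algebra_simps)
  qed
  ultimately show ?thesis by (simp add: has_vector_derivative_def)
qed

text \<open>The mean value inequality in \<open>t\<close> gives one square integrable majorant for
  all difference quotients with \<bar>t\<bar> \<le> 1.\<close>

lemma dilate_increment_bound:
  assumes \<eta>: "\<eta> \<in> test_functions"
  shows "\<exists>g\<in>L2. \<forall>x. \<forall>t\<in>{-1..1}. cmod (dilate t \<eta> x - \<eta> x) \<le> \<bar>t\<bar> * cmod (g x)"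
proof -
  obtain R where R: "\<And>x. \<eta> x \<noteq> 0 \<Longrightarrow> norm x \<le> R" and sm: "smooth \<eta>"
    using \<eta> test_functions_iff by blast
  obtain M where M: "\<And>x. cmod (generator \<eta> x) \<le> M"
    using test_function_generator_bounded[OF \<eta>] by blast
  have M0: "0 \<le> M" using M[of 0] norm_ge_zero order_trans by blast
  \<comment> \<open>For \<bar>s\<bar> \<le> 1 the prefactor of the dilation is at most
    \<open>exp (real CARD('a) / 2)\<close>, so \<open>K\<close> bounds the derivative in
    \<open>s\<close>.\<close>
  define K where "K = exp (real CARD('a) / 2) * M"
  have K0: "0 \<le> K" using M0 by (simp add: K_def)
  \<comment> \<open>Outside this ball \<open>exp s *\<^sub>R x\<close> has norm at least
    \<bar>R\<bar> + 1 for every \<open>s \<ge> -1\<close>, so both \<eta> and its dilation vanish at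
    \<open>x\<close>.\<close>
  define g :: "real ^ 'a \<Rightarrow> complex" where "g x = (if norm x < exp 1 * (\<bar>R\<bar> + 1) then of_real K else 0)" for x
  have "g \<in> L2" unfolding g_def by (rule continuous_ball_L2) simp
  moreover have "cmod (dilate t \<eta> x - \<eta> x) \<le> \<bar>t\<bar> * cmod (g x)" if t: "t \<in> {-1..1}" for x t
  proof (cases "norm x < exp 1 * (\<bar>R\<bar> + 1)")
    case True
    have "norm (dilate t \<eta> x - dilate 0 \<eta> x) \<le> K * norm (t - 0)"
    proof (rule differentiable_bound[of "{-1..1}"])
      show "((\<lambda>t. dilate t \<eta> x) has_derivative (\<lambda>h. h *\<^sub>R dilate s (generator \<eta>) x)) (at s within {-1..1})" for s
        using dilate_has_vector_derivative[OF sm] has_derivative_at_withinI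
        unfolding has_vector_derivative_def by blast
      show "onorm (\<lambda>h. h *\<^sub>R dilate s (generator \<eta>) x) \<le> K" if s: "s \<in> {-1..1}" for s
      proof (rule onorm_le)
        fix h :: real
        have "cmod (dilate s (generator \<eta>) x) \<le> K"
          unfolding dilate_def K_def norm_mult norm_of_real using s M
          by (intro mult_mono) (auto simp: field_simps)
        then show "norm (h *\<^sub>R dilate s (generator \<eta>) x) \<le> K * norm h"
          by (simp add: mult.commute[of K] mult_left_mono)
      qed
    qed (use t in auto)
    then show ?thesis using True K0 by (simp add: g_def mult.commute)
  next
    case False
    have e: "exp 1 * (\<bar>R\<bar> + 1) \<le> norm x" using False by simp
    have "norm (exp s *\<^sub>R x) > R" if "s \<ge> -1" for s
    proof -
      have "R < exp (-1) * (exp 1 * (\<bar>R\<bar> + 1))" by (simp add: mult.assoc[symmetric] flip: exp_add)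
      also have "\<dots> \<le> exp s * norm x" using that e by (intro mult_mono) auto
      finally show ?thesis by simp
    qed
    from this[of t] this[of 0] have "\<eta> (exp t *\<^sub>R x) = 0" "\<eta> x = 0"
      using R[of "exp t *\<^sub>R x"] R[of x] t by force+
    then show ?thesis by (simp add: dilate_def)
  qed
  ultimately show ?thesis by blast
qed

lemma integral_dilate_has_vector_derivative_0:
  assumes \<phi>: "\<phi> \<in> L2" and \<eta>: "\<eta> \<in> test_functions"
  shows "((\<lambda>t. \<integral>x. \<phi> x * dilate t \<eta> x \<partial>lebesgue) has_vector_derivative
     (\<integral>x. \<phi> x * generator \<eta> x \<partial>lebesgue)) (at 0)"
  unfolding has_vector_derivative_at_iff_quotient tendsto_at_iff_sequentially
proof (intro allI impI)
  fix X :: "nat \<Rightarrow> real" assume X0: "\<forall>i. X i \<in> UNIV - {0}" and X: "X \<longlonglongrightarrow> 0"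
  have sm: "smooth \<eta>" using \<eta> by (rule test_function_smooth)
  obtain g where g: "g \<in> L2"
    and le: "\<And>x t. t \<in> {-1..1} \<Longrightarrow> cmod (dilate t \<eta> x - \<eta> x) \<le> \<bar>t\<bar> * cmod (g x)"
    using dilate_increment_bound[OF \<eta>] by blast
  have "\<forall>\<^sub>F i in sequentially. \<bar>X i\<bar> < 1"
    using order_tendstoD(2)[OF tendsto_rabs[OF X], of 1] by simp
  then obtain N where N: "\<And>i. i \<ge> N \<Longrightarrow> \<bar>X i\<bar> < 1"
    unfolding eventually_sequentially by blast
  \<comment> \<open>Dropping the first \<open>N\<close> terms keeps the sequence in the range where
    the majorant is valid.\<close>
  define Y where "Y i = X (i + N)" for i
  have Y: "Y i \<noteq> 0" "\<bar>Y i\<bar> < 1" "Y \<longlonglongrightarrow> 0" for i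
    using X0 N[of "i + N"] LIMSEQ_ignore_initial_segment[OF X] unfolding Y_def by auto
  let ?q = "\<lambda>i x. (dilate (Y i) \<eta> x - \<eta> x) /\<^sub>R Y i"
  have dl: "dilate t \<eta> \<in> L2" for t by (intro dilate_L2 test_function_L2 \<eta>)
  have int: "integrable lebesgue (\<lambda>x. \<phi> x * dilate t \<eta> x)" for t
    by (rule L2_mult_integrable[OF \<phi> dl])
  have lim: "(\<lambda>i. \<integral>x. \<phi> x * ?q i x \<partial>lebesgue) \<longlonglongrightarrow> (\<integral>x. \<phi> x * generator \<eta> x \<partial>lebesgue)"
  proof (rule integral_dominated_convergence[where w = "\<lambda>x. cmod (\<phi> x) * cmod (g x)"])
    have q: "(\<lambda>i. ?q i x) \<longlonglongrightarrow> generator \<eta> x" for x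
    proof -
      have "((\<lambda>h. (dilate (0 + h) \<eta> x - dilate 0 \<eta> x) /\<^sub>R h) \<longlongrightarrow> dilate 0 (generator \<eta>) x) (at 0)"
        by (rule has_vector_derivative_at_iff_quotient[THEN iffD1, OF dilate_has_vector_derivative[OF sm]])
      then have "((\<lambda>h. (dilate h \<eta> x - \<eta> x) /\<^sub>R h) \<circ> Y) \<longlonglongrightarrow> generator \<eta> x"
        unfolding tendsto_at_iff_sequentially using Y by simp
      then show ?thesis by (simp add: o_def)
    qed
    then show "AE x in lebesgue. (\<lambda>i. \<phi> x * ?q i x) \<longlonglongrightarrow> \<phi> x * generator \<eta> x"
      by (intro AE_I2 tendsto_mult_left)
    have qm: "?q i \<in> borel_measurable lebesgue" for i
      using L2_measurable[OF dl] L2_measurable[OF test_function_L2[OF \<eta>]] by simp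
    then have "generator \<eta> \<in> borel_measurable lebesgue"
      by (rule borel_measurable_LIMSEQ_metric) (use q in auto)
    then show "(\<lambda>x. \<phi> x * generator \<eta> x) \<in> borel_measurable lebesgue"
      using L2_measurable[OF \<phi>] by simp
    show "(\<lambda>x. \<phi> x * ?q i x) \<in> borel_measurable lebesgue" for i
      using L2_measurable[OF \<phi>] qm by (intro borel_measurable_times)
    show "integrable lebesgue (\<lambda>x. cmod (\<phi> x) * cmod (g x))"
      by (rule L2_mult_integrable_norm[OF \<phi> g])
    show "AE x in lebesgue. norm (\<phi> x * ?q i x) \<le> cmod (\<phi> x) * cmod (g x)" for i
    proof (rule AE_I2)
      fix x
      have "cmod (?q i x) = cmod (dilate (Y i) \<eta> x - \<eta> x) / \<bar>Y i\<bar>"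
        by (simp add: divide_inverse mult.commute)
      also have "\<dots> \<le> cmod (g x)"
        using le[of "Y i" x] Y(1)[of i] Y(2)[of i] by (simp add: field_simps abs_less_iff)
      finally show "norm (\<phi> x * ?q i x) \<le> cmod (\<phi> x) * cmod (g x)"
        unfolding norm_mult by (rule mult_left_mono) simp
    qed
  qed
  have eq: "(\<integral>x. \<phi> x * ?q i x \<partial>lebesgue) =
     ((\<integral>x. \<phi> x * dilate (Y i) \<eta> x \<partial>lebesgue) - (\<integral>x. \<phi> x * dilate 0 \<eta> x \<partial>lebesgue)) /\<^sub>R Y i" for i
  proof -
    have "(\<integral>x. \<phi> x * ?q i x \<partial>lebesgue) = (\<integral>x. (\<phi> x * dilate (Y i) \<eta> x - \<phi> x * dilate 0 \<eta> x) /\<^sub>R Y i \<partial>lebesgue)"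
      by (simp add: algebra_simps)
    also have "\<dots> = (\<integral>x. \<phi> x * dilate (Y i) \<eta> x - \<phi> x * dilate 0 \<eta> x \<partial>lebesgue) /\<^sub>R Y i"
      by (rule integral_scaleR_right)
    also have "\<dots> = ((\<integral>x. \<phi> x * dilate (Y i) \<eta> x \<partial>lebesgue) - (\<integral>x. \<phi> x * dilate 0 \<eta> x \<partial>lebesgue)) /\<^sub>R Y i"
      by (subst Bochner_Integration.integral_diff[OF int int]) simp
    finally show ?thesis .
  qed
  show "((\<lambda>h. ((\<integral>x. \<phi> x * dilate (0 + h) \<eta> x \<partial>lebesgue) - (\<integral>x. \<phi> x * dilate 0 \<eta> x \<partial>lebesgue)) /\<^sub>R h) \<circ> X)
    \<longlonglongrightarrow> (\<integral>x. \<phi> x * generator \<eta> x \<partial>lebesgue)"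
    by (rule LIMSEQ_offset[where k = N]) (use lim[unfolded eq] in \<open>simp add: Y_def o_def\<close>)
qed

text \<open>By the group law the increment from time \<open>t\<close> is the increment from time 0
  of the test function \<open>dilate t \<eta>\<close>.\<close>

lemma integral_dilate_has_vector_derivative:
  assumes "\<phi> \<in> L2" "\<eta> \<in> test_functions"
  shows "((\<lambda>t. \<integral>x. \<phi> x * dilate t \<eta> x \<partial>lebesgue) has_vector_derivative
     (\<integral>x. \<phi> x * generator (dilate t \<eta>) x \<partial>lebesgue)) (at t)"
  using integral_dilate_has_vector_derivative_0[OF assms(1) test_function_dilate[OF assms(2), of t]]
  unfolding has_vector_derivative_at_iff_quotient
  by (simp add: dilate_dilate add.commute)

section \<open>Weak derivatives paired with the generator\<close>

lemma H1_weak_partial: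
  assumes "\<phi> \<in> H1"
  shows "weak_partial j \<phi> \<in> L2" "has_weak_partial \<phi> j (weak_partial j \<phi>)"
proof -
  have "\<exists>g. g \<in> L2 \<and> has_weak_partial \<phi> j g" using assms by (auto simp: H1_def)
  then have "weak_partial j \<phi> \<in> L2 \<and> has_weak_partial \<phi> j (weak_partial j \<phi>)"
    unfolding weak_partial_def by (rule someI_ex)
  then show "weak_partial j \<phi> \<in> L2" "has_weak_partial \<phi> j (weak_partial j \<phi>)" by auto
qed

text \<open>In divergence form each weight \<open>x $ j\<close> stands inside the derivative, so the
  weak derivative is tested against \<open>x $ j\<close> times \<eta>, again a test function. This
  gives the formal skew-adjointness of the generator.\<close>

lemma integral_generator:
  fixes \<phi> :: "real ^ 'n \<Rightarrow> complex"
  assumes \<phi>: "\<phi> \<in> H1" and \<eta>: "\<eta> \<in> test_functions"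
  shows "(\<integral>x. \<phi> x * generator \<eta> x \<partial>lebesgue) =
    - (\<integral>x. (x_dot_grad \<phi> x + of_real (real CARD('n) / 2) * \<phi> x) * \<eta> x \<partial>lebesgue)"
proof -
  have L: "\<phi> \<in> L2" using \<phi> by (simp add: H1_def)
  let ?c = "complex_of_real (real CARD('n) / 2)"
  let ?x\<eta> = "\<lambda>j x. complex_of_real (x $ j) * \<eta> x"
  have x\<eta>: "?x\<eta> j \<in> test_functions" for j
    by (rule test_function_mult[OF smooth_component \<eta>])
  have int1: "integrable lebesgue (\<lambda>x. \<phi> x * partial_deriv j (?x\<eta> j) x)" for j
    by (intro L2_mult_integrable[OF L] test_function_L2 test_function_partial_deriv x\<eta>)
  have int2: "integrable lebesgue (\<lambda>x. weak_partial j \<phi> x * ?x\<eta> j x)" for j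
    by (intro L2_mult_integrable H1_weak_partial[OF \<phi>] test_function_L2 x\<eta>)
  have int3: "integrable lebesgue (\<lambda>x. ?c * (\<phi> x * \<eta> x))"
    by (intro integrable_mult_right L2_mult_integrable[OF L] test_function_L2 \<eta>)
  have "(\<integral>x. \<phi> x * generator \<eta> x \<partial>lebesgue) =
    (\<integral>x. (\<Sum>j\<in>UNIV. \<phi> x * partial_deriv j (?x\<eta> j) x) - ?c * (\<phi> x * \<eta> x) \<partial>lebesgue)"
    by (simp add: generator_def sum_distrib_left algebra_simps)
  also have "\<dots> = (\<Sum>j\<in>UNIV. \<integral>x. \<phi> x * partial_deriv j (?x\<eta> j) x \<partial>lebesgue) - (\<integral>x. ?c * (\<phi> x * \<eta> x) \<partial>lebesgue)"
    by (subst Bochner_Integration.integral_diff[OF Bochner_Integration.integrable_sum[OF int1] int3],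
        subst Bochner_Integration.integral_sum[OF int1]) simp
  also have "\<dots> = - ((\<Sum>j\<in>UNIV. \<integral>x. weak_partial j \<phi> x * ?x\<eta> j x \<partial>lebesgue) + (\<integral>x. ?c * (\<phi> x * \<eta> x) \<partial>lebesgue))"
    using H1_weak_partial(2)[OF \<phi>] x\<eta> by (simp add: has_weak_partial_def sum_negf)
  also have "\<dots> = - (\<integral>x. (\<Sum>j\<in>UNIV. weak_partial j \<phi> x * ?x\<eta> j x) + ?c * (\<phi> x * \<eta> x) \<partial>lebesgue)"
    by (subst Bochner_Integration.integral_add[OF Bochner_Integration.integrable_sum[OF int2] int3],
        subst Bochner_Integration.integral_sum[OF int2]) simp
  also have "\<dots> = - (\<integral>x. (x_dot_grad \<phi> x + ?c * \<phi> x) * \<eta> x \<partial>lebesgue)"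
    by (simp add: x_dot_grad_def sum_distrib_right sum_distrib_left algebra_simps)
  finally show ?thesis .
qed

section \<open>Skew-adjointness and kernel of the generator\<close>

text \<open>Here \<xi> stands for the generator applied to \<phi> in the weak sense. By
  \<open>weak\<close> and Cauchy-Schwarz the derivative in \<open>t\<close> is at most
  \<open>L2_norm \<xi> * L2_norm \<eta>\<close>, uniformly because dilations preserve the norm; the
  mean value inequality then gives the bound.\<close>

lemma dilate_increment_test_function:
  assumes \<phi>: "\<phi> \<in> L2" and \<xi>: "\<xi> \<in> L2"
    and weak: "\<And>\<eta>. \<eta> \<in> test_functions \<Longrightarrow>
      (\<integral>x. \<phi> x * generator \<eta> x \<partial>lebesgue) = - (\<integral>x. \<xi> x * \<eta> x \<partial>lebesgue)"
    and \<eta>: "\<eta> \<in> test_functions"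
  shows "cmod ((\<integral>x. \<phi> x * dilate t \<eta> x \<partial>lebesgue) - (\<integral>x. \<phi> x * \<eta> x \<partial>lebesgue))
    \<le> \<bar>t\<bar> * (L2_norm \<xi> * L2_norm \<eta>)"
proof -
  let ?G = "\<lambda>t. \<integral>x. \<phi> x * dilate t \<eta> x \<partial>lebesgue"
  let ?D = "\<lambda>s. \<integral>x. \<phi> x * generator (dilate s \<eta>) x \<partial>lebesgue"
  have "norm (?G t - ?G 0) \<le> L2_norm \<xi> * L2_norm \<eta> * norm (t - 0)"
  proof (rule differentiable_bound[of UNIV])
    show "(?G has_derivative (\<lambda>h. h *\<^sub>R ?D s)) (at s within UNIV)" for s
      using integral_dilate_has_vector_derivative[OF \<phi> \<eta>] unfolding has_vector_derivative_def .
    show "onorm (\<lambda>h. h *\<^sub>R ?D s) \<le> L2_norm \<xi> * L2_norm \<eta>" for s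
    proof (rule onorm_le)
      fix h :: real
      have "cmod (?D s) \<le> L2_norm \<xi> * L2_norm (dilate s \<eta>)"
        using L2_Cauchy_Schwarz[OF \<xi> test_function_L2[OF test_function_dilate[OF \<eta>]]]
        by (simp add: weak[OF test_function_dilate[OF \<eta>]])
      then have "cmod (?D s) \<le> L2_norm \<xi> * L2_norm \<eta>"
        by (simp add: L2_norm_dilate[OF test_function_L2[OF \<eta>]])
      from mult_left_mono[OF this abs_ge_zero[of h]]
      show "norm (h *\<^sub>R ?D s) \<le> L2_norm \<xi> * L2_norm \<eta> * norm h"
        by (simp add: mult_ac)
    qed
  qed auto
  then show ?thesis by (simp add: mult.commute)
qed

lemma le_plus_eps_imp_le:
  fixes a b c :: real
  assumes "\<And>\<epsilon>. \<epsilon> > 0 \<Longrightarrow> a \<le> b + \<epsilon> * c"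
  shows "a \<le> b"
proof (rule tendsto_lowerbound)
  show "((\<lambda>\<epsilon>. b + \<epsilon> * c) \<longlongrightarrow> b) (at_right 0)"
    by (auto intro!: tendsto_eq_intros)
  show "\<forall>\<^sub>F \<epsilon> in at_right 0. a \<le> b + \<epsilon> * c"
    using assms by (auto simp: eventually_at_filter)
qed simp

lemma L2_norm_le_plus:
  assumes "f \<in> L2" "g \<in> L2"
  shows "L2_norm g \<le> L2_norm f + L2_norm (\<lambda>x. f x - g x)"
  using L2_norm_triangle[OF assms(1) L2_diff[OF assms(2,1)]]
  by (simp add: L2_norm_minus_commute[of f g])

lemma integral_mult_diff_right:
  assumes "\<phi> \<in> L2" "f \<in> L2" "g \<in> L2"
  shows "(\<integral>x. \<phi> x * (f x - g x) \<partial>lebesgue) = (\<integral>x. \<phi> x * f x \<partial>lebesgue) - (\<integral>x. \<phi> x * g x \<partial>lebesgue)"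
  using Bochner_Integration.integral_diff[OF L2_mult_integrable[OF assms(1,2)] L2_mult_integrable[OF assms(1,3)]]
  by (simp add: right_diff_distrib)

lemma integral_dilate_diff:
  assumes "\<phi> \<in> L2" "f \<in> L2" "g \<in> L2"
  shows "(\<integral>x. \<phi> x * dilate t (\<lambda>x. f x - g x) x \<partial>lebesgue) =
    (\<integral>x. \<phi> x * dilate t f x \<partial>lebesgue) - (\<integral>x. \<phi> x * dilate t g x \<partial>lebesgue)"
  unfolding dilate_diff by (rule integral_mult_diff_right[OF assms(1) dilate_L2(1) dilate_L2(1), OF assms(2,3)])

text \<open>Both sides depend continuously on \<open>f\<close> in L2, so density extends the bound
  from test functions. The approximation errors add up to a fixed multiple of \<epsilon>.\<close>

lemma dilate_increment:
  assumes \<phi>: "\<phi> \<in> L2" and \<xi>: "\<xi> \<in> L2"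
    and weak: "\<And>\<eta>. \<eta> \<in> test_functions \<Longrightarrow>
      (\<integral>x. \<phi> x * generator \<eta> x \<partial>lebesgue) = - (\<integral>x. \<xi> x * \<eta> x \<partial>lebesgue)"
    and f: "f \<in> L2"
  shows "cmod ((\<integral>x. \<phi> x * dilate t f x \<partial>lebesgue) - (\<integral>x. \<phi> x * f x \<partial>lebesgue))
    \<le> \<bar>t\<bar> * (L2_norm \<xi> * L2_norm f)"
proof (rule le_plus_eps_imp_le)
  fix \<epsilon> :: real assume "\<epsilon> > 0"
  then obtain \<eta> where \<eta>: "\<eta> \<in> test_functions" and lt: "L2_norm (\<lambda>x. f x - \<eta> x) < \<epsilon>"
    using test_functions_dense[OF f] unfolding approximable_def by blast
  have \<eta>L: "\<eta> \<in> L2" using \<eta> by (rule test_function_L2)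
  have d: "(\<lambda>x. f x - \<eta> x) \<in> L2" by (rule L2_diff[OF f \<eta>L])
  let ?a = "(\<integral>x. \<phi> x * dilate t \<eta> x \<partial>lebesgue) - (\<integral>x. \<phi> x * \<eta> x \<partial>lebesgue)"
  let ?b = "\<integral>x. \<phi> x * dilate t (\<lambda>x. f x - \<eta> x) x \<partial>lebesgue"
  let ?c = "\<integral>x. \<phi> x * (f x - \<eta> x) \<partial>lebesgue"
  have eq: "(\<integral>x. \<phi> x * dilate t f x \<partial>lebesgue) - (\<integral>x. \<phi> x * f x \<partial>lebesgue) = ?a + (?b - ?c)"
    by (simp add: integral_dilate_diff[OF \<phi> f \<eta>L] integral_mult_diff_right[OF \<phi> f \<eta>L])
  have "cmod ?a \<le> \<bar>t\<bar> * (L2_norm \<xi> * L2_norm \<eta>)"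
    by (rule dilate_increment_test_function[OF \<phi> \<xi> weak \<eta>])
  also have "\<dots> \<le> \<bar>t\<bar> * (L2_norm \<xi> * (L2_norm f + \<epsilon>))"
    using L2_norm_le_plus[OF f \<eta>L] lt by (intro mult_left_mono) auto
  finally have a: "cmod ?a \<le> \<bar>t\<bar> * (L2_norm \<xi> * (L2_norm f + \<epsilon>))" .
  have "cmod ?b \<le> L2_norm \<phi> * L2_norm (\<lambda>x. f x - \<eta> x)"
    using L2_Cauchy_Schwarz[OF \<phi> dilate_L2(1)[OF d]] L2_norm_dilate[OF d] by metis
  moreover have "cmod ?c \<le> L2_norm \<phi> * L2_norm (\<lambda>x. f x - \<eta> x)"
    by (rule L2_Cauchy_Schwarz[OF \<phi> d])
  moreover have "L2_norm \<phi> * L2_norm (\<lambda>x. f x - \<eta> x) \<le> L2_norm \<phi> * \<epsilon>"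
    using lt by (intro mult_left_mono) auto
  ultimately have "cmod (?b - ?c) \<le> 2 * (L2_norm \<phi> * \<epsilon>)"
    using norm_triangle_ineq4[of ?b ?c] by linarith
  then have "cmod (?a + (?b - ?c)) \<le> \<bar>t\<bar> * (L2_norm \<xi> * (L2_norm f + \<epsilon>)) + 2 * (L2_norm \<phi> * \<epsilon>)"
    using a norm_triangle_ineq[of ?a "?b - ?c"] by linarith
  then show "cmod ((\<integral>x. \<phi> x * dilate t f x \<partial>lebesgue) - (\<integral>x. \<phi> x * f x \<partial>lebesgue))
    \<le> \<bar>t\<bar> * (L2_norm \<xi> * L2_norm f) + \<epsilon> * (\<bar>t\<bar> * L2_norm \<xi> + 2 * L2_norm \<phi>)"
    unfolding eq by (simp add: algebra_simps)
qed

text \<open>Split \<open>f\<close> into a test function, whose quotients are known to converge, and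
  a small remainder, whose quotients are controlled by the increment bound.\<close>

lemma dilate_derivative_L2:
  assumes \<phi>: "\<phi> \<in> L2" and \<xi>: "\<xi> \<in> L2"
    and weak: "\<And>\<eta>. \<eta> \<in> test_functions \<Longrightarrow>
      (\<integral>x. \<phi> x * generator \<eta> x \<partial>lebesgue) = - (\<integral>x. \<xi> x * \<eta> x \<partial>lebesgue)"
    and f: "f \<in> L2"
  shows "((\<lambda>t. ((\<integral>x. \<phi> x * dilate t f x \<partial>lebesgue) - (\<integral>x. \<phi> x * f x \<partial>lebesgue)) /\<^sub>R t)
     \<longlongrightarrow> - (\<integral>x. \<xi> x * f x \<partial>lebesgue)) (at 0)"
proof (rule tendstoI)
  fix e :: real assume e: "e > 0"
  let ?Q = "\<lambda>f t. ((\<integral>x. \<phi> x * dilate t f x \<partial>lebesgue) - (\<integral>x. \<phi> x * f x \<partial>lebesgue)) /\<^sub>R t"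
  let ?L = "\<lambda>f. \<integral>x. \<xi> x * f x \<partial>lebesgue"
  \<comment> \<open>The quotient and the limit of the remainder may each cost \<open>e / 4\<close>,
    leaving \<open>e / 2\<close> for the test function. The summand 1 covers
    \<open>L2_norm \<xi> = 0\<close>.\<close>
  define \<delta> where "\<delta> = e / (4 * (L2_norm \<xi> + 1))"
  have pos: "0 < L2_norm \<xi> + 1" using L2_norm_nonneg[of \<xi>] by linarith
  have \<delta>: "\<delta> > 0" using e pos by (simp add: \<delta>_def)
  have "X * (e / (4 * X)) = e / 4" if "X > 0" for X :: real using that by simp
  from this[OF pos] have "(L2_norm \<xi> + 1) * \<delta> = e / 4" unfolding \<delta>_def .
  moreover have "L2_norm \<xi> * \<delta> \<le> (L2_norm \<xi> + 1) * \<delta>" using \<delta> by (intro mult_right_mono) auto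
  ultimately have \<xi>\<delta>: "L2_norm \<xi> * \<delta> \<le> e / 4" by simp
  obtain \<eta> where \<eta>: "\<eta> \<in> test_functions" and lt: "L2_norm (\<lambda>x. f x - \<eta> x) < \<delta>"
    using test_functions_dense[OF f] \<delta> unfolding approximable_def by blast
  have \<eta>L: "\<eta> \<in> L2" using \<eta> by (rule test_function_L2)
  let ?d = "\<lambda>x. f x - \<eta> x"
  have d: "?d \<in> L2" by (rule L2_diff[OF f \<eta>L])
  have \<xi>d: "L2_norm \<xi> * L2_norm ?d \<le> e / 4"
    using mult_left_mono[OF less_imp_le[OF lt] L2_norm_nonneg[of \<xi>]] \<xi>\<delta> by linarith
  have "(?Q \<eta> \<longlongrightarrow> - ?L \<eta>) (at 0)"
    using integral_dilate_has_vector_derivative_0[OF \<phi> \<eta>]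
    unfolding has_vector_derivative_at_iff_quotient weak[OF \<eta>] by simp
  then have "\<forall>\<^sub>F t in at 0. dist (?Q \<eta> t) (- ?L \<eta>) < e / 2"
    using e by (intro tendstoD) auto
  moreover have "\<forall>\<^sub>F t in at 0. t \<noteq> (0 :: real)" by (simp add: eventually_at_filter)
  ultimately show "\<forall>\<^sub>F t in at 0. dist (?Q f t) (- ?L f) < e"
  proof eventually_elim
    case (elim t)
    have "?Q f t = ?Q \<eta> t + ?Q ?d t"
      by (simp add: integral_dilate_diff[OF \<phi> f \<eta>L] integral_mult_diff_right[OF \<phi> f \<eta>L]
          flip: scaleR_add_right)
    moreover have "?L f = ?L \<eta> + ?L ?d"
      by (simp add: integral_mult_diff_right[OF \<xi> f \<eta>L])
    ultimately have eq: "?Q f t - - ?L f = (?Q \<eta> t - - ?L \<eta>) + (?Q ?d t + ?L ?d)" by simp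
    \<comment> \<open>After division by \<bar>t\<bar> the increment bound is independent of
      \<open>t\<close>, so the remainder is small uniformly near 0.\<close>
    have "cmod (?Q ?d t) = cmod ((\<integral>x. \<phi> x * dilate t ?d x \<partial>lebesgue) - (\<integral>x. \<phi> x * ?d x \<partial>lebesgue)) / \<bar>t\<bar>"
      by (simp add: divide_inverse mult.commute)
    also have "\<dots> \<le> L2_norm \<xi> * L2_norm ?d"
      using dilate_increment[OF \<phi> \<xi> weak d, of t] elim(2) by (simp add: field_simps)
    finally have q: "cmod (?Q ?d t) \<le> e / 4" using \<xi>d by linarith
    have l: "cmod (?L ?d) \<le> e / 4" using L2_Cauchy_Schwarz[OF \<xi> d] \<xi>d by linarith
    have "cmod (?Q \<eta> t - - ?L \<eta>) < e / 2" using elim(1) by (simp only: dist_norm)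
    then have "cmod ((?Q \<eta> t - - ?L \<eta>) + (?Q ?d t + ?L ?d)) < e"
      using q l norm_triangle_ineq[of "?Q \<eta> t - - ?L \<eta>" "?Q ?d t + ?L ?d"]
        norm_triangle_ineq[of "?Q ?d t" "?L ?d"] by linarith
    then show ?case unfolding dist_norm eq .
  qed
qed

lemma integral_mult_cnj:
  "(\<integral>x. \<phi> x * cnj (\<phi> x) \<partial>lebesgue) = of_real ((L2_norm \<phi>)\<^sup>2)"
  by (simp add: L2_norm_squared complex_norm_square[symmetric] flip: of_real_power)

text \<open>
  By the Cauchy-Schwarz inequality \<open>Re \<integral> \<phi> (U\<^sub>t (cnj \<phi>) - cnj \<phi>) \<le> 0\<close> for both signs of \<open>t\<close>, so the real
  part of the derivative at \<open>0\<close> vanishes.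
\<close>

lemma generator_skew:
  assumes \<phi>: "\<phi> \<in> L2" and \<xi>: "\<xi> \<in> L2"
    and weak: "\<And>\<eta>. \<eta> \<in> test_functions \<Longrightarrow>
      (\<integral>x. \<phi> x * generator \<eta> x \<partial>lebesgue) = - (\<integral>x. \<xi> x * \<eta> x \<partial>lebesgue)"
  shows "Re (\<integral>x. \<xi> x * cnj (\<phi> x) \<partial>lebesgue) = 0"
proof -
  let ?f = "\<lambda>x. cnj (\<phi> x)"
  let ?N = "\<lambda>t. (\<integral>x. \<phi> x * dilate t ?f x \<partial>lebesgue) - (\<integral>x. \<phi> x * ?f x \<partial>lebesgue)"
  have f: "?f \<in> L2" using \<phi> by (rule L2_cnj)
  have N: "Re (?N t) \<le> 0" for t
  proof -
    have "L2_norm ?f = L2_norm \<phi>" by (simp add: L2_norm_def)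
    then have "cmod (\<integral>x. \<phi> x * dilate t ?f x \<partial>lebesgue) \<le> (L2_norm \<phi>)\<^sup>2"
      using L2_Cauchy_Schwarz[OF \<phi> dilate_L2(1)[OF f], of t] L2_norm_dilate[OF f, of t]
      by (simp add: power2_eq_square)
    then show ?thesis
      using complex_Re_le_cmod[of "\<integral>x. \<phi> x * dilate t ?f x \<partial>lebesgue"]
      by (simp add: integral_mult_cnj)
  qed
  have "((\<lambda>t. Re (?N t /\<^sub>R t)) \<longlongrightarrow> Re (- (\<integral>x. \<xi> x * ?f x \<partial>lebesgue))) (at 0)"
    by (intro tendsto_Re dilate_derivative_L2[OF \<phi> \<xi> weak f])
  then have lim: "((\<lambda>t. Re (?N t) / t) \<longlongrightarrow> - Re (\<integral>x. \<xi> x * ?f x \<partial>lebesgue)) (at 0)"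
    by (simp add: divide_inverse mult.commute)
  have "- Re (\<integral>x. \<xi> x * ?f x \<partial>lebesgue) \<le> 0"
  proof (rule tendsto_upperbound)
    show "((\<lambda>t. Re (?N t) / t) \<longlongrightarrow> - Re (\<integral>x. \<xi> x * ?f x \<partial>lebesgue)) (at_right 0)"
      using lim by (rule filterlim_mono) (simp_all add: at_le)
    show "\<forall>\<^sub>F t in at_right 0. Re (?N t) / t \<le> 0"
      using N unfolding eventually_at_filter by (intro always_eventually) (auto intro: divide_nonpos_pos)
  qed simp
  moreover have "0 \<le> - Re (\<integral>x. \<xi> x * ?f x \<partial>lebesgue)"
  proof (rule tendsto_lowerbound)
    show "((\<lambda>t. Re (?N t) / t) \<longlongrightarrow> - Re (\<integral>x. \<xi> x * ?f x \<partial>lebesgue)) (at_left 0)"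
      using lim by (rule filterlim_mono) (simp_all add: at_le)
    show "\<forall>\<^sub>F t in at_left 0. 0 \<le> Re (?N t) / t"
      using N unfolding eventually_at_filter by (intro always_eventually) (auto intro: divide_nonpos_neg)
  qed simp
  ultimately show ?thesis by linarith
qed

lemma generator_kernel:
  fixes \<phi> :: "real ^ 'n \<Rightarrow> complex"
  assumes \<phi>: "\<phi> \<in> L2" and \<xi>: "\<xi> \<in> L2" "L2_norm \<xi> = 0"
    and weak: "\<And>\<eta>. \<eta> \<in> test_functions \<Longrightarrow>
      (\<integral>x. \<phi> x * generator \<eta> x \<partial>lebesgue) = - (\<integral>x. \<xi> x * \<eta> x \<partial>lebesgue)"
  shows "AE x in lebesgue. \<phi> x = 0"
proof -
  have test: "(\<integral>x. \<phi> x * \<eta> x \<partial>lebesgue) = 0" if \<eta>: "\<eta> \<in> test_functions" for \<eta>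
  proof -
    obtain R where R: "\<And>x. \<eta> x \<noteq> 0 \<Longrightarrow> norm x \<le> R"
      using \<eta> test_functions_iff by blast
    have \<eta>L: "\<eta> \<in> L2" using \<eta> by (rule test_function_L2)
    \<comment> \<open>The dilation by the factor \<open>Suc k\<close> squeezes the support of \<eta>
      into this ball, so only this part of \<phi> is seen by the dilated test function.\<close>
    define s where "s k x = (if norm x \<le> R / real (Suc k) then \<phi> x else 0)" for k x
    have "(\<lambda>x. norm x) \<in> borel_measurable lebesgue"
      by (intro borel_measurable_norm measurable_completion) auto
    then have sm: "s k \<in> borel_measurable lebesgue" for k
      using L2_measurable[OF \<phi>] unfolding s_def by measurable
    have sL: "s k \<in> L2" for k
      by (rule L2_dominated[OF \<phi> sm]) (simp add: s_def)
    have "(\<lambda>k. L2_norm (\<lambda>x. (\<lambda>x. 0) x - s k x)) \<longlonglongrightarrow> 0"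
    proof (rule L2_norm_tendsto_0[OF _ sm \<phi>])
      show "cmod (0 - s k x) \<le> cmod (\<phi> x)" for k x by (simp add: s_def)
      \<comment> \<open>Every nonzero point eventually leaves the shrinking balls, and the origin is
        a null set.\<close>
      have "AE x in lebesgue. x \<noteq> (0 :: real ^ 'n)"
        using AE_not_in[of "{0 :: real ^ 'n}" lebesgue] negligible_iff_null_sets[of "{0 :: real ^ 'n}"] by simp
      then show "AE x in lebesgue. (\<lambda>k. s k x) \<longlonglongrightarrow> 0"
      proof eventually_elim
        case (elim x)
        have "(\<lambda>k. R * inverse (real (Suc k))) \<longlonglongrightarrow> R * 0"
          by (intro tendsto_mult_left LIMSEQ_inverse_real_of_nat)
        then have "\<forall>\<^sub>F k in sequentially. R * inverse (real (Suc k)) < norm x"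
          using elim by (intro order_tendstoD(2)) auto
        then have "\<forall>\<^sub>F k in sequentially. s k x = 0"
          by eventually_elim (simp add: s_def divide_inverse)
        then show ?case by (rule tendsto_eventually)
      qed
    qed simp
    then have "(\<lambda>k. L2_norm (s k) * L2_norm \<eta>) \<longlonglongrightarrow> 0 * L2_norm \<eta>"
      by (intro tendsto_mult_right) (simp add: L2_norm_def)
    moreover have "cmod (\<integral>x. \<phi> x * \<eta> x \<partial>lebesgue) \<le> L2_norm (s k) * L2_norm \<eta>" for k
    proof -
      let ?t = "ln (real (Suc k))"
      \<comment> \<open>Since \<xi> has norm 0, the increment bound makes the pairing constant along
        the dilations.\<close>
      have "(\<integral>x. \<phi> x * \<eta> x \<partial>lebesgue) = (\<integral>x. \<phi> x * dilate ?t \<eta> x \<partial>lebesgue)"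
        using dilate_increment_test_function[OF \<phi> \<xi>(1) weak \<eta>, of ?t] \<xi>(2) by simp
      also have "\<dots> = (\<integral>x. s k x * dilate ?t \<eta> x \<partial>lebesgue)"
      proof (rule Bochner_Integration.integral_cong[OF refl])
        fix x
        have "\<eta> (exp ?t *\<^sub>R x) = 0" if "\<not> norm x \<le> R / real (Suc k)"
        proof -
          have "R < real (Suc k) * norm x"
            using that by (simp add: not_le divide_less_eq mult.commute)
          also have "\<dots> = norm (exp ?t *\<^sub>R x)" by simp
          finally show ?thesis using R[of "exp ?t *\<^sub>R x"] by linarith
        qed
        then show "\<phi> x * dilate ?t \<eta> x = s k x * dilate ?t \<eta> x"
          unfolding dilate_def s_def by (cases "norm x \<le> R / real (Suc k)") simp_all
      qed
      finally show ?thesis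
        using L2_Cauchy_Schwarz[OF sL dilate_L2(1)[OF \<eta>L], of k ?t] L2_norm_dilate[OF \<eta>L, of ?t]
        by simp
    qed
    ultimately have "cmod (\<integral>x. \<phi> x * \<eta> x \<partial>lebesgue) \<le> 0 * L2_norm \<eta>"
      by (intro LIMSEQ_le_const) auto
    then show ?thesis by simp
  qed
  have "(L2_norm \<phi>)\<^sup>2 \<le> 0"
  proof (rule le_plus_eps_imp_le)
    fix \<epsilon> :: real assume "\<epsilon> > 0"
    have f: "(\<lambda>x. cnj (\<phi> x)) \<in> L2" using \<phi> by (rule L2_cnj)
    obtain \<eta> where \<eta>: "\<eta> \<in> test_functions" and lt: "L2_norm (\<lambda>x. cnj (\<phi> x) - \<eta> x) < \<epsilon>"
      using test_functions_dense[OF f] \<open>\<epsilon> > 0\<close> unfolding approximable_def by blast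
    have \<eta>L: "\<eta> \<in> L2" using \<eta> by (rule test_function_L2)
    \<comment> \<open>Pairings of \<phi> with test functions vanish, so \<eta> can be subtracted
      without changing the integral.\<close>
    have "of_real ((L2_norm \<phi>)\<^sup>2) = (\<integral>x. \<phi> x * (cnj (\<phi> x) - \<eta> x) \<partial>lebesgue)"
      by (simp add: integral_mult_diff_right[OF \<phi> f \<eta>L] test[OF \<eta>] integral_mult_cnj)
    then have "cmod (of_real ((L2_norm \<phi>)\<^sup>2)) \<le> L2_norm \<phi> * L2_norm (\<lambda>x. cnj (\<phi> x) - \<eta> x)"
      using L2_Cauchy_Schwarz[OF \<phi> L2_diff[OF f \<eta>L]] by simp
    also have "\<dots> \<le> L2_norm \<phi> * \<epsilon>" using lt by (intro mult_left_mono) auto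
    finally show "(L2_norm \<phi>)\<^sup>2 \<le> 0 + \<epsilon> * L2_norm \<phi>"
      by (simp add: norm_power mult.commute)
  qed
  then show ?thesis using L2_norm_eq_0_iff[OF \<phi>] by simp
qed

section \<open>Expansion of the square and conclusion\<close>

lemma L2_norm_add_scaled_squared:
  fixes c :: real
  assumes f: "f \<in> L2" and g: "g \<in> L2"
  shows "(L2_norm (\<lambda>x. f x + of_real c * g x))\<^sup>2 =
    (L2_norm f)\<^sup>2 + 2 * c * Re (\<integral>x. f x * cnj (g x) \<partial>lebesgue) + c\<^sup>2 * (L2_norm g)\<^sup>2"
proof -
  have int: "integrable lebesgue (\<lambda>x. f x * cnj (g x))"
    by (rule L2_mult_integrable[OF f L2_cnj[OF g]])
  have "(cmod (f x + of_real c * g x))\<^sup>2 =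
    (cmod (f x))\<^sup>2 + 2 * c * Re (f x * cnj (g x)) + c\<^sup>2 * (cmod (g x))\<^sup>2" for x
    unfolding cmod_power2 by (simp add: power2_eq_square algebra_simps)
  then have "(L2_norm (\<lambda>x. f x + of_real c * g x))\<^sup>2 =
    (\<integral>x. (cmod (f x))\<^sup>2 + 2 * c * Re (f x * cnj (g x)) + c\<^sup>2 * (cmod (g x))\<^sup>2 \<partial>lebesgue)"
    by (simp add: L2_norm_squared)
  also have "\<dots> = (\<integral>x. (cmod (f x))\<^sup>2 \<partial>lebesgue) + 2 * c * (\<integral>x. Re (f x * cnj (g x)) \<partial>lebesgue)
    + c\<^sup>2 * (\<integral>x. (cmod (g x))\<^sup>2 \<partial>lebesgue)"
    using L2_integrable[OF f] L2_integrable[OF g] integrable_Re[OF int]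
    by (simp del: times_complex.sel)
  also have "(\<integral>x. Re (f x * cnj (g x)) \<partial>lebesgue) = Re (\<integral>x. f x * cnj (g x) \<partial>lebesgue)"
    by (rule integral_Re[OF int])
  finally show ?thesis by (simp add: L2_norm_squared)
qed

theorem theorem3p2:
  shows "(\<forall>\<phi> \<in> (H1 :: (real ^ 'n \<Rightarrow> complex) set). x_dot_grad \<phi> \<in> L2 \<longrightarrow>
            (L2_norm (x_dot_grad \<phi>))\<^sup>2 =
              (L2_norm (\<lambda>x. x_dot_grad \<phi> x + of_real (real CARD('n) / 2) * \<phi> x))\<^sup>2
              + (real CARD('n) / 2)\<^sup>2 * (L2_norm \<phi>)\<^sup>2)
       \<and> \<not> (\<exists>\<phi> \<in> (H1 :: (real ^ 'n \<Rightarrow> complex) set).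
            \<not> (AE x in lebesgue. \<phi> x = 0) \<and> x_dot_grad \<phi> \<in> L2 \<and>
            (L2_norm (x_dot_grad \<phi>))\<^sup>2 = (real CARD('n) / 2)\<^sup>2 * (L2_norm \<phi>)\<^sup>2)"
proof -
  let ?c = "real CARD('n) / 2"
  let ?\<xi> = "\<lambda>\<phi> x. x_dot_grad \<phi> x + of_real ?c * \<phi> x"
  have \<xi>: "?\<xi> \<phi> \<in> L2" if "\<phi> \<in> H1" "x_dot_grad \<phi> \<in> L2" for \<phi> :: "real ^ 'n \<Rightarrow> complex"
    using that by (intro L2_add L2_cmult) (auto simp: H1_def)
  have eq: "(L2_norm (x_dot_grad \<phi>))\<^sup>2 = (L2_norm (?\<xi> \<phi>))\<^sup>2 + ?c\<^sup>2 * (L2_norm \<phi>)\<^sup>2"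
    if \<phi>: "\<phi> \<in> H1" and \<psi>: "x_dot_grad \<phi> \<in> L2" for \<phi> :: "real ^ 'n \<Rightarrow> complex"
  proof -
    have L: "\<phi> \<in> L2" using \<phi> by (simp add: H1_def)
    have "Re (\<integral>x. ?\<xi> \<phi> x * cnj (\<phi> x) \<partial>lebesgue) = 0"
      by (rule generator_skew[OF L \<xi>[OF \<phi> \<psi>] integral_generator[OF \<phi>]])
    \<comment> \<open>Adding \<open>- ?c\<close> times \<phi> to \<open>?\<xi> \<phi>\<close>
      recovers \<open>x_dot_grad \<phi>\<close>, and the cross term vanishes by
      skew-adjointness.\<close>
    then show ?thesis
      using L2_norm_add_scaled_squared[OF \<xi>[OF \<phi> \<psi>] L, of "- ?c"] by simp
  qed
  \<comment> \<open>Comparing \<open>min\<close> with the identity leaves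
    \<open>L2_norm (?\<xi> \<phi>) = 0\<close>, so \<phi> lies in the kernel of the generator, which
    is trivial.\<close>
  have "AE x in lebesgue. \<phi> x = 0"
    if \<phi>: "\<phi> \<in> H1" and \<psi>: "x_dot_grad \<phi> \<in> L2"
      and min: "(L2_norm (x_dot_grad \<phi>))\<^sup>2 = ?c\<^sup>2 * (L2_norm \<phi>)\<^sup>2" for \<phi> :: "real ^ 'n \<Rightarrow> complex"
  proof (rule generator_kernel[OF _ \<xi>[OF \<phi> \<psi>] _ integral_generator[OF \<phi>]])
    show "\<phi> \<in> L2" using \<phi> by (simp add: H1_def)
    show "L2_norm (?\<xi> \<phi>) = 0" using eq[OF \<phi> \<psi>] min by simp
  qed
  with eq show ?thesis by blast
qed

end
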